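(* Let $N\ge 1$, $T\in[0,\infty)$ and $x_0\in\mathbb{R}^N$. For all $i,j\in\{1,\dots,N\}$ let $p_{ij}:\mathbb{R}^N\to[0,1]$ be globally Lipschitz continuous. For $h>0$ let $X^h$ be the trajectory on $[0,T]$ of the agent-based model (described in the context) with timestep $h$, initial opinions $x_0$ and update distance $\mu^h=Nh$. Then, as $h\to 0$, $X^h$ converges in distribution (and therefore, the limit being deterministic, also in probability) in $D([0,T],\mathbb{R}^N)$ to the solution $X=(X(t):t\in[0,T])$ of the ODE system $$\frac{dX_i}{dt}=\frac1N\sum_{j=1}^N p_{ij}(X)\,(X_j-X_i),\quad i=1,\dots,N,\qquad X(0)=x_0 .$$
   Context: Agent-based model with timestep $h>0$: the opinions $x(t)=(x_1(t),\dots,x_N(t))\in\mathbb{R}^N$ evolve at times $t=0,h,2h,\dots$ as a discrete-time Markov chain with $x(0)=x_0$. At each timestep a pair $(i,j)\in\{1,\dots,N\}^2$ is chosen uniformly at random with replacement (each ordered pair, including $i=j$, has probability $N^{-2}$), independently of the past. Then, given the current state $x=x(t)$, $$x_i(t+h)=\begin{cases}x_i(t)+\mu^h\,(x_j(t)-x_i(t)) & \text{with probability } p_{ij}(x),\\ x_i(t) & \text{with probability } 1-p_{ij}(x),\end{cases}$$ and all other coordinates are unchanged. The trajectory $X^h=(X^h_t)_{t\in[0,T]}$ is the piecewise constant process $X^h_t=x(h\lfloor t/h\rfloor)$, viewed as a random element of the Skorokhod space $D([0,T],\mathbb{R}^N)$ of càdlàg functions. Convergence in distribution means $\mathbb{E}[f(X^h)]\to\mathbb{E}[f(X)]$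 for every bounded continuous real-valued $f$ on $D([0,T],\mathbb{R}^N)$. Convergence in probability to a deterministic $X$ means $\mathbb{P}[d(X^h,X)<\epsilon]\to1$ for every $\epsilon>0$, where $d$ is the metric of $D([0,T],\mathbb{R}^N)$. *)

theory Defs
  imports "HOL-Probability.Probability"
begin

section \<open>The Skorokhod space on a compact interval\<close>

text \<open>Functions on \<open>[0,T]\<close> are represented extensionally (with value \<open>undefined\<close> outside of
  \<open>{0..T}\<close>), so that equality in \<open>cadlag T\<close> is equality on \<open>[0,T]\<close>.\<close>

definition cadlag :: "real \<Rightarrow> (real \<Rightarrow> 'a::metric_space) set" where
  "cadlag T = {f \<in> extensional {0..T}.
     (\<forall>t\<in>{0..<T}. (f \<longlongrightarrow> f t) (at_right t)) \<and>
     (\<forall>t\<in>{0<..T}. \<exists>l. (f \<longlongrightarrow> l) (at_left t))}"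

definition time_changes :: "real \<Rightarrow> (real \<Rightarrow> real) set" where
  "time_changes T = {l. strict_mono_on {0..T} l \<and> continuous_on {0..T} l \<and> l ` {0..T} = {0..T}}"

text \<open>Billingsley's metric for the \<open>J\<^sub>1\<close> topology: the infimum of those \<open>e > 0\<close> for which some
  time change \<open>l\<close> satisfies \<open>\<bar>l t - t\<bar> \<le> e\<close> and \<open>dist (x t) (y (l t)) \<le> e\<close> uniformly in \<open>t\<close>.
  The value \<open>0\<close> outside of \<open>cadlag T\<close> is only there because \<^locale>\<open>Metric_space\<close> asks for
  nonnegativity and symmetry on the whole type.\<close>

definition skorokhod_dist :: "real \<Rightarrow> (real \<Rightarrow> 'a::metric_space) \<Rightarrow> (real \<Rightarrow> 'a) \<Rightarrow> real" where
  "skorokhod_dist T x y =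
     (if x \<in> cadlag T \<and> y \<in> cadlag T
      then Inf {e. 0 < e \<and> (\<exists>l\<in>time_changes T. \<forall>t\<in>{0..T}. \<bar>l t - t\<bar> \<le> e \<and> dist (x t) (y (l t)) \<le> e)}
      else 0)"

definition skorokhod_topology :: "real \<Rightarrow> (real \<Rightarrow> 'a::metric_space) topology" where
  "skorokhod_topology T = Metric_space.mtopology (cadlag T) (skorokhod_dist T)"

definition skorokhod_borel :: "real \<Rightarrow> (real \<Rightarrow> 'a::metric_space) measure" where
  "skorokhod_borel T = sigma (cadlag T) {U. openin (skorokhod_topology T) U}"

subsection \<open>\<open>skorokhod_dist\<close> is a metric\<close>

definition skorokhod_close ::
  "real \<Rightarrow> (real \<Rightarrow> 'a::metric_space) \<Rightarrow> (real \<Rightarrow> 'a) \<Rightarrow> real set" where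
  "skorokhod_close T x y =
     {e. 0 < e \<and> (\<exists>l\<in>time_changes T. \<forall>t\<in>{0..T}. \<bar>l t - t\<bar> \<le> e \<and> dist (x t) (y (l t)) \<le> e)}"

lemma skorokhod_dist_eq:
  "x \<in> cadlag T \<Longrightarrow> y \<in> cadlag T \<Longrightarrow> skorokhod_dist T x y = Inf (skorokhod_close T x y)"
  by (simp add: skorokhod_dist_def skorokhod_close_def)

lemma time_changes_id: "(\<lambda>t. t) \<in> time_changes T"
  by (auto simp: time_changes_def strict_mono_on_def)

lemma time_changes_comp:
  assumes "l \<in> time_changes T" "m \<in> time_changes T"
  shows "(\<lambda>t. m (l t)) \<in> time_changes T"
proof -
  have l: "strict_mono_on {0..T} l" "continuous_on {0..T} l" "l ` {0..T} = {0..T}"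
    and m: "strict_mono_on {0..T} m" "continuous_on {0..T} m" "m ` {0..T} = {0..T}"
    using assms by (auto simp: time_changes_def)
  have "strict_mono_on {0..T} (\<lambda>t. m (l t))"
    using l m unfolding strict_mono_on_def by (metis imageI)
  moreover have "continuous_on {0..T} (\<lambda>t. m (l t))"
    using continuous_on_compose2[OF m(2) l(2)] l(3) by simp
  moreover have "(\<lambda>t. m (l t)) ` {0..T} = {0..T}"
    using l(3) m(3) by (metis image_image)
  ultimately show ?thesis by (simp add: time_changes_def)
qed

lemma time_changes_inv:
  assumes "l \<in> time_changes T"
  shows "inv_into {0..T} l \<in> time_changes T"
proof -
  have l: "strict_mono_on {0..T} l" "continuous_on {0..T} l" "l ` {0..T} = {0..T}"
    using assms by (auto simp: time_changes_def)
  have inj: "inj_on l {0..T}"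
    using l(1) by (rule strict_mono_on_imp_inj_on)
  let ?k = "inv_into {0..T} l"
  have k: "?k t \<in> {0..T}" "l (?k t) = t" if "t \<in> {0..T}" for t
    using that l(3) inv_into_into[of t l "{0..T}"] f_inv_into_f[of t l "{0..T}"] by auto
  have "strict_mono_on {0..T} ?k"
  proof (rule strict_mono_onI)
    fix r s assume rs: "r \<in> {0..T}" "s \<in> {0..T}" "r < s"
    show "?k r < ?k s"
    proof (rule ccontr)
      assume "\<not> ?k r < ?k s"
      then have "l (?k s) \<le> l (?k r)"
        using l(1) k[OF rs(1)] k[OF rs(2)]
        by (metis le_less not_less strict_mono_onD)
      then show False using k rs by simp
    qed
  qed
  moreover have "continuous_on {0..T} ?k"
    using continuous_on_inv[OF l(2), of ?k] inj l(3) by simp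
  moreover have "?k ` {0..T} = {0..T}"
    using inj l(3) by (metis inv_into_image_cancel order_refl)
  ultimately show ?thesis by (simp add: time_changes_def)
qed

lemma time_changes_end:
  assumes "l \<in> time_changes T" "0 \<le> T"
  shows "l T = T"
proof -
  have l: "strict_mono_on {0..T} l" "l ` {0..T} = {0..T}"
    using assms by (auto simp: time_changes_def)
  have "T \<in> l ` {0..T}" using l(2) assms(2) by simp
  then obtain s where s: "s \<in> {0..T}" "l s = T" by blast
  have "l T \<in> {0..T}" using l(2) assms(2) by auto
  then show ?thesis
    using s l(1) assms(2) by (smt (verit) atLeastAtMost_iff strict_mono_onD)
qed

lemma skorokhod_close_sym: "skorokhod_close T x y \<subseteq> skorokhod_close T y x"
proof
  fix e assume "e \<in> skorokhod_close T x y"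
  then obtain l where e: "0 < e" and l: "l \<in> time_changes T"
    and *: "\<And>t. t \<in> {0..T} \<Longrightarrow> \<bar>l t - t\<bar> \<le> e \<and> dist (x t) (y (l t)) \<le> e"
    unfolding skorokhod_close_def by blast
  let ?k = "inv_into {0..T} l"
  have im: "l ` {0..T} = {0..T}" using l by (auto simp: time_changes_def)
  have "\<bar>?k t - t\<bar> \<le> e \<and> dist (y t) (x (?k t)) \<le> e" if "t \<in> {0..T}" for t
  proof -
    have "?k t \<in> {0..T}" "l (?k t) = t"
      using that im inv_into_into[of t l "{0..T}"] f_inv_into_f[of t l "{0..T}"] by auto
    then show ?thesis using *[of "?k t"] by (auto simp: dist_commute)
  qed
  then show "e \<in> skorokhod_close T y x"
    using e time_changes_inv[OF l] unfolding skorokhod_close_def by blast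
qed

lemma skorokhod_close_add:
  assumes "a \<in> skorokhod_close T x y" "b \<in> skorokhod_close T y z"
  shows "a + b \<in> skorokhod_close T x z"
proof -
  obtain l where a: "0 < a" and l: "l \<in> time_changes T"
    and la: "\<And>t. t \<in> {0..T} \<Longrightarrow> \<bar>l t - t\<bar> \<le> a \<and> dist (x t) (y (l t)) \<le> a"
    using assms(1) unfolding skorokhod_close_def by blast
  obtain m where b: "0 < b" and m: "m \<in> time_changes T"
    and mb: "\<And>t. t \<in> {0..T} \<Longrightarrow> \<bar>m t - t\<bar> \<le> b \<and> dist (y t) (z (m t)) \<le> b"
    using assms(2) unfolding skorokhod_close_def by blast
  have "\<bar>m (l t) - t\<bar> \<le> a + b \<and> dist (x t) (z (m (l t))) \<le> a + b" if t: "t \<in> {0..T}" for t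
  proof -
    have "l t \<in> {0..T}" using l t by (auto simp: time_changes_def)
    from la[OF t] mb[OF this] show ?thesis
      using dist_triangle[of "x t" "z (m (l t))" "y (l t)"] by auto
  qed
  then show ?thesis
    using a b time_changes_comp[OF l m] unfolding skorokhod_close_def
    by (intro CollectI conjI bexI[of _ "\<lambda>t. m (l t)"] ballI) auto
qed

lemma cadlag_bounded:
  fixes f :: "real \<Rightarrow> 'a::metric_space"
  assumes f: "f \<in> cadlag T"
  shows "bounded (f ` {0..T})"
proof (cases "0 \<le> T")
  case True
  define S where "S = {0..T}"
  have "bounded (f ` ({0..T} \<inter> S))" using True
  proof (induction rule: Bolzano)
    case (trans a b c)
    have "f ` ({a..c} \<inter> S) \<subseteq> f ` ({a..b} \<inter> S) \<union> f ` ({b..c} \<inter> S)"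
      by force
    moreover have "bounded (f ` ({a..b} \<inter> S) \<union> f ` ({b..c} \<inter> S))"
      using trans by (simp only: bounded_Un)
    ultimately show ?case by (rule bounded_subset[rotated])
  next
    case (local t)
    have R: "\<exists>r>t. bounded (f ` ({t<..<r} \<inter> S))"
    proof (cases "t < T")
      case True
      then have "(f \<longlongrightarrow> f t) (at_right t)" using f local by (auto simp: cadlag_def)
      then have "\<forall>\<^sub>F s in at_right t. dist (f s) (f t) < 1" by (rule tendstoD) simp
      then obtain r where "r > t" "\<And>s. t < s \<Longrightarrow> s < r \<Longrightarrow> dist (f s) (f t) < 1"
        unfolding eventually_at_right_field by blast
      then have "f ` ({t<..<r} \<inter> S) \<subseteq> ball (f t) 1" by (auto simp: dist_commute)
      then show ?thesis using \<open>r > t\<close> bounded_ball bounded_subset by blast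
    next
      case False
      then have "{t<..<t+1} \<inter> S = {}" by (auto simp: S_def)
      then show ?thesis by (intro exI[of _ "t+1"]) simp
    qed
    have L: "\<exists>r<t. bounded (f ` ({r<..<t} \<inter> S))"
    proof (cases "0 < t")
      case True
      then have "t \<in> {0<..T}" using local by simp
      then obtain l where "(f \<longlongrightarrow> l) (at_left t)" using f unfolding cadlag_def by blast
      then have "\<forall>\<^sub>F s in at_left t. dist (f s) l < 1" by (rule tendstoD) simp
      then obtain r where "r < t" "\<And>s. r < s \<Longrightarrow> s < t \<Longrightarrow> dist (f s) l < 1"
        unfolding eventually_at_left_field by blast
      then have "f ` ({r<..<t} \<inter> S) \<subseteq> ball l 1" by (auto simp: dist_commute)
      then show ?thesis using \<open>r < t\<close> bounded_ball bounded_subset by blast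
    next
      case False
      then have "{t-1<..<t} \<inter> S = {}" by (auto simp: S_def)
      then show ?thesis by (intro exI[of _ "t-1"]) simp
    qed
    obtain r1 where r1: "r1 > t" "bounded (f ` ({t<..<r1} \<inter> S))" using R by blast
    obtain r2 where r2: "r2 < t" "bounded (f ` ({r2<..<t} \<inter> S))" using L by blast
    have "bounded (f ` ({a..b} \<inter> S))" if "a \<le> t" "t \<le> b" "b - a < min (r1 - t) (t - r2)" for a b
    proof -
      have "f ` ({a..b} \<inter> S) \<subseteq>
          insert (f t) (f ` ({t<..<r1} \<inter> S) \<union> f ` ({r2<..<t} \<inter> S))"
      proof
        fix v assume "v \<in> f ` ({a..b} \<inter> S)"
        then obtain u where u: "a \<le> u" "u \<le> b" "u \<in> S" "v = f u" by auto
        then have "r2 < u" "u < r1" using that by linarith+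
        then show "v \<in> insert (f t) (f ` ({t<..<r1} \<inter> S) \<union> f ` ({r2<..<t} \<inter> S))"
          using u by (cases u t rule: linorder_cases) auto
      qed
      moreover have "bounded (insert (f t) (f ` ({t<..<r1} \<inter> S) \<union> f ` ({r2<..<t} \<inter> S)))"
        using r1(2) r2(2) by (simp only: bounded_Un bounded_insert)
      ultimately show ?thesis by (rule bounded_subset[rotated])
    qed
    then show ?case
      using r1(1) r2(1) by (intro exI[of _ "min (r1 - t) (t - r2)"]) auto
  qed
  then show ?thesis by (simp add: S_def)
qed simp

lemma skorokhod_close_nonempty:
  assumes "x \<in> cadlag T" "y \<in> cadlag T"
  shows "skorokhod_close T x y \<noteq> {}"
proof -
  have "bounded (x ` {0..T} \<union> y ` {0..T})"
    using cadlag_bounded[OF assms(1)] cadlag_bounded[OF assms(2)] by simp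
  then obtain B where B: "\<And>u v. u \<in> x ` {0..T} \<union> y ` {0..T} \<Longrightarrow> v \<in> x ` {0..T} \<union> y ` {0..T}
      \<Longrightarrow> dist u v \<le> B"
    unfolding bounded_two_points by blast
  have "max B 1 \<in> skorokhod_close T x y"
    unfolding skorokhod_close_def
    by (auto intro!: bexI[OF _ time_changes_id] B simp: le_max_iff_disj)
  then show ?thesis by blast
qed

lemma skorokhod_close_bdd_below: "bdd_below (skorokhod_close T x y)"
  by (rule bdd_belowI[of _ 0]) (simp add: skorokhod_close_def)

lemma skorokhod_dist_nonneg: "0 \<le> skorokhod_dist T x y"
proof (cases "x \<in> cadlag T \<and> y \<in> cadlag T")
  case True
  then show ?thesis
    using skorokhod_close_nonempty[of x T y]
    by (auto simp: skorokhod_dist_eq skorokhod_close_def intro!: cInf_greatest)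
qed (auto simp: skorokhod_dist_def)

lemma skorokhod_dist_lessD:
  assumes "x \<in> cadlag T" "y \<in> cadlag T" "skorokhod_dist T x y < e"
  shows "\<exists>a\<in>skorokhod_close T x y. a < e"
  using assms skorokhod_close_nonempty[OF assms(1,2)]
  by (simp add: skorokhod_dist_eq cInf_less_iff skorokhod_close_bdd_below)

lemma skorokhod_dist_le:
  assumes "x \<in> cadlag T" "y \<in> cadlag T" "a \<in> skorokhod_close T x y"
  shows "skorokhod_dist T x y \<le> a"
  using assms by (simp add: skorokhod_dist_eq cInf_lower skorokhod_close_bdd_below)

lemma skorokhod_dist_zeroD:
  fixes x y :: "real \<Rightarrow> 'a::metric_space"
  assumes T: "0 \<le> T" and x: "x \<in> cadlag T" and y: "y \<in> cadlag T"
    and d: "skorokhod_dist T x y = 0"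
  shows "x = y"
proof (rule extensionalityI)
  show "x \<in> extensional {0..T}" "y \<in> extensional {0..T}"
    using x y by (auto simp: cadlag_def)
  fix t assume t: "t \<in> {0..T}"
  have close: "\<exists>l\<in>time_changes T. \<forall>s\<in>{0..T}. \<bar>l s - s\<bar> \<le> e \<and> dist (x s) (y (l s)) \<le> e"
    if "e > 0" for e
    using skorokhod_dist_lessD[OF x y, of e] d that unfolding skorokhod_close_def
    by (smt (verit, best) mem_Collect_eq)
  show "x t = y t"
  proof (cases "t < T")
    case False
    then have "t = T" using t by simp
    have "dist (x T) (y T) \<le> e" if "e > 0" for e
      using close[OF that] time_changes_end[OF _ T] T by force
    then show ?thesis
      using \<open>t = T\<close> by (metis dist_le_zero_iff field_le_epsilon add_0)
  next
    case True
    have lim: "(x \<longlongrightarrow> x t) (at_right t)" "(y \<longlongrightarrow> y t) (at_right t)"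
      using x y t True by (auto simp: cadlag_def)
    have "dist (x t) (y t) \<le> 0 + e" if e: "e > 0" for e
    proof -
      have "\<forall>\<^sub>F s in at_right t. dist (x s) (x t) < e/3 \<and> dist (y s) (y t) < e/3"
        using tendstoD[OF lim(1), of "e/3"] tendstoD[OF lim(2), of "e/3"] e
        by (simp add: eventually_conj)
      then obtain r where r: "r > t"
        "\<And>s. t < s \<Longrightarrow> s < r \<Longrightarrow> dist (x s) (x t) < e/3 \<and> dist (y s) (y t) < e/3"
        unfolding eventually_at_right_field by blast
      define q where "q = min r T - t"
      define s where "s = t + q / 2"
      have q: "q > 0" "t + q \<le> r" "t + q \<le> T" using r True by (auto simp: q_def)
      have s: "s \<in> {0..T}" "t < s" "s < r" using q t by (auto simp: s_def)
      obtain l where l: "\<bar>l s - s\<bar> \<le> min (e/3) (q/4)" "dist (x s) (y (l s)) \<le> min (e/3) (q/4)"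
        using close[of "min (e/3) (q/4)"] e q(1) s(1) by (meson divide_pos_pos min_less_iff_conj zero_less_numeral)
      have "\<bar>l s - s\<bar> \<le> q/4" using l(1) by (simp only: min.bounded_iff)
      then have "t < l s" "l s < r" using q s_def by linarith+
      then have "dist (y (l s)) (y t) < e/3" using r(2) by blast
      moreover have "dist (x s) (x t) < e/3" using r(2) s by blast
      moreover have "dist (x s) (y (l s)) \<le> e/3" using l(2) by simp
      ultimately show ?thesis
        using dist_triangle[of "x t" "y t" "x s"] dist_triangle[of "x s" "y t" "y (l s)"]
        by (simp add: dist_commute)
    qed
    then have "dist (x t) (y t) \<le> 0" by (rule field_le_epsilon)
    then show ?thesis by simp
  qed
qed

lemma skorokhod_dist_refl: "skorokhod_dist T x x = 0"
proof (cases "x \<in> cadlag T")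
  case True
  have "e \<in> skorokhod_close T x x" if "e > 0" for e
    using that unfolding skorokhod_close_def by (auto intro!: bexI[OF _ time_changes_id])
  then have "skorokhod_dist T x x \<le> 0 + e" if "e > 0" for e
    using skorokhod_dist_le[OF True True] that by simp
  then have "skorokhod_dist T x x \<le> 0" by (rule field_le_epsilon)
  then show ?thesis using skorokhod_dist_nonneg[of T x x] by simp
qed (simp add: skorokhod_dist_def)

lemma Metric_space_skorokhod:
  assumes "0 \<le> T"
  shows "Metric_space (cadlag T) (skorokhod_dist T)"
proof
  fix x y z :: "real \<Rightarrow> 'a"
  show "0 \<le> skorokhod_dist T x y" by (rule skorokhod_dist_nonneg)
  have "skorokhod_close T x y = skorokhod_close T y x"
    using skorokhod_close_sym by blast
  then show "skorokhod_dist T x y = skorokhod_dist T y x"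
    by (simp add: skorokhod_dist_def flip: skorokhod_close_def)
  assume x: "x \<in> cadlag T" and y: "y \<in> cadlag T"
  show "skorokhod_dist T x y = 0 \<longleftrightarrow> x = y"
    using skorokhod_dist_zeroD[OF assms x y] skorokhod_dist_refl by blast
  assume z: "z \<in> cadlag T"
  show "skorokhod_dist T x z \<le> skorokhod_dist T x y + skorokhod_dist T y z"
  proof (rule field_le_epsilon)
    fix e :: real assume "e > 0"
    then obtain a b where a: "a \<in> skorokhod_close T x y" "a < skorokhod_dist T x y + e/2"
      and b: "b \<in> skorokhod_close T y z" "b < skorokhod_dist T y z + e/2"
      using skorokhod_dist_lessD[OF x y, of "skorokhod_dist T x y + e/2"]
        skorokhod_dist_lessD[OF y z, of "skorokhod_dist T y z + e/2"] by auto
    have "skorokhod_dist T x z \<le> a + b"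
      using skorokhod_dist_le[OF x z skorokhod_close_add[OF a(1) b(1)]] .
    then show "skorokhod_dist T x z \<le> skorokhod_dist T x y + skorokhod_dist T y z + e"
      using a(2) b(2) by simp
  qed
qed

section \<open>Convergence of random elements of the Skorokhod space\<close>

definition converges_in_distribution ::
  "real \<Rightarrow> ('i \<Rightarrow> 'w measure) \<Rightarrow> ('i \<Rightarrow> 'w \<Rightarrow> real \<Rightarrow> 'a::metric_space)
   \<Rightarrow> 'v measure \<Rightarrow> ('v \<Rightarrow> real \<Rightarrow> 'a) \<Rightarrow> 'i filter \<Rightarrow> bool" where
  "converges_in_distribution T M Y L X F \<longleftrightarrow>
     (\<forall>f. continuous_map (skorokhod_topology T) euclideanreal f \<and> bounded (f ` cadlag T) \<longrightarrow>
        ((\<lambda>h. \<integral>\<omega>. f (Y h \<omega>) \<partial>M h) \<longlongrightarrow> (\<integral>\<omega>. f (X \<omega>) \<partial>L)) F)"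

definition converges_in_probability ::
  "real \<Rightarrow> ('i \<Rightarrow> 'w measure) \<Rightarrow> ('i \<Rightarrow> 'w \<Rightarrow> real \<Rightarrow> 'a::metric_space)
   \<Rightarrow> (real \<Rightarrow> 'a) \<Rightarrow> 'i filter \<Rightarrow> bool" where
  "converges_in_probability T M Y X F \<longleftrightarrow>
     (\<forall>e>0. ((\<lambda>h. measure (M h) {\<omega> \<in> space (M h). skorokhod_dist T (Y h \<omega>) X < e}) \<longlongrightarrow> 1) F)"

section \<open>Markov chains\<close>

text \<open>The sigma-algebra generated by \<open>x 0, \<dots>, x n\<close>.\<close>

definition history :: "'w measure \<Rightarrow> (nat \<Rightarrow> 'w \<Rightarrow> 'a::topological_space) \<Rightarrow> nat \<Rightarrow> 'w measure" where
  "history M x n =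
     vimage_algebra (space M) (\<lambda>\<omega>. \<lambda>k\<in>{..n}. x k \<omega>) (\<Pi>\<^sub>M k\<in>{..n}. borel)"

text \<open>The conditional law of \<open>x (Suc n)\<close> given \<open>x 0, \<dots>, x n\<close> is \<open>K (x n)\<close>.\<close>

definition markov_chain ::
  "'w measure \<Rightarrow> ('a::topological_space \<Rightarrow> 'a pmf) \<Rightarrow> 'a \<Rightarrow> (nat \<Rightarrow> 'w \<Rightarrow> 'a) \<Rightarrow> bool" where
  "markov_chain M K x0 x \<longleftrightarrow>
     prob_space M \<and> (\<forall>n. x n \<in> borel_measurable M) \<and> (AE \<omega> in M. x 0 \<omega> = x0) \<and>
     (\<forall>n. \<forall>B\<in>sets borel. AE \<omega> in M.
        real_cond_exp M (history M x n) (\<lambda>\<omega>. indicator B (x (Suc n) \<omega>)) \<omega> = measure_pmf.prob (K (x n \<omega>)) B)"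

section \<open>The agent-based model and the limiting ODE\<close>

definition abm_kernel ::
  "('n \<Rightarrow> 'n \<Rightarrow> real^'n \<Rightarrow> real) \<Rightarrow> real \<Rightarrow> real^'n \<Rightarrow> (real^'n::finite) pmf" where
  "abm_kernel p \<mu> a =
     bind_pmf (pmf_of_set UNIV) (\<lambda>(i, j).
     bind_pmf (bernoulli_pmf (p i j a)) (\<lambda>interact.
     return_pmf (if interact then (\<chi> k. if k = i then a $ i + \<mu> * (a $ j - a $ i) else a $ k) else a)))"

text \<open>\<open>x n\<close> is the state at time \<open>n * h\<close>.\<close>

definition piecewise_trajectory ::
  "real \<Rightarrow> real \<Rightarrow> (nat \<Rightarrow> 'w \<Rightarrow> 'a) \<Rightarrow> 'w \<Rightarrow> real \<Rightarrow> 'a" where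
  "piecewise_trajectory T h x \<omega> = (\<lambda>t\<in>{0..T}. x (nat \<lfloor>t / h\<rfloor>) \<omega>)"

definition abm_ode_solution ::
  "('n \<Rightarrow> 'n \<Rightarrow> real^'n \<Rightarrow> real) \<Rightarrow> real \<Rightarrow> real^'n \<Rightarrow> (real \<Rightarrow> real^'n::finite) \<Rightarrow> bool" where
  "abm_ode_solution p T x0 X \<longleftrightarrow>
     X \<in> extensional {0..T} \<and> X 0 = x0 \<and>
     (\<forall>t\<in>{0..T}. \<forall>i. ((\<lambda>s. X s $ i) has_real_derivative
        1 / real CARD('n) * (\<Sum>j\<in>UNIV. p i j (X t) * (X t $ j - X t $ i))) (at t within {0..T}))"

end

theory Submission
  imports Defs
begin

text \<open>The drift of the chain per unit time is exactly the right-hand side of the ODE, and opinions never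
  leave the box spanned by the initial ones once \<open>N h \<le> 1\<close>. On that box the drift is Lipschitz and
  each step has size \<open>O(h)\<close>, so \<open>E |x(n h) - X(n h)|\<^sup>2\<close> satisfies a discrete Gronwall inequality
  with an \<open>O(h\<^sup>2)\<close> error per step and is \<open>O(h)\<close> uniformly in \<open>n h \<le> T\<close>. Both the trajectories
  and the ODE solution are Lipschitz in time (up to one step), so controlling the deviation on a grid
  of \<open>O(h powr (- 1/2))\<close> times suffices for uniform closeness, without any maximal inequality; the
  Skorokhod distance is at most the uniform one. Uniqueness of the ODE solution is inherited from
  uniqueness of limits in probability, and existence follows from Picard iteration for the drift
  composed with the projection to the box.\<close>

section \<open>Random elements of the Skorokhod space\<close>

text \<open>The scaling \<open>N * h\<close> matches the sampling: a given pair has probability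
  1/N^2, so coordinate i moves on average by N * h / N^2 times the sum over j, which is h times the
  right-hand side. The noise is negligible because a step of size O(h) has variance O(h^2) and only
  about T/h steps occur. Two obstacles shape the rest. The drift multiplies a Lipschitz
  \<open>p i j\<close> by an unbounded difference, so in general it is Lipschitz only on bounded
  sets; hence the box. And \<open>markov_chain\<close> speaks of conditional expectations on an
  arbitrary probability space, where moments are awkward to compute. Two consequences are extracted
  from it: the law of each single state, as a finitely supported \<open>pmf\<close>, and the almost
  sure fact that every transition lies in the support of the kernel. The first yields the moments,
  the second the regularity of paths.\<close>

lemma topspace_skorokhod:
  fixes T :: real
  assumes "0 \<le> T"
  shows "topspace (skorokhod_topology T :: (real \<Rightarrow> 'a::metric_space) topology) = cadlag T"
  unfolding skorokhod_topology_def by (rule Metric_space.topspace_mtopology[OF Metric_space_skorokhod[OF assms]])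

lemma openin_skorokhod_subset:
  fixes T :: real and U :: "(real \<Rightarrow> 'a::metric_space) set"
  assumes "0 \<le> T" "openin (skorokhod_topology T) U"
  shows "U \<subseteq> cadlag T"
  using openin_subset[OF assms(2)] topspace_skorokhod[OF assms(1)] by blast

lemma space_skorokhod_borel:
  fixes T :: real
  assumes "0 \<le> T"
  shows "space (skorokhod_borel T :: (real \<Rightarrow> 'a::metric_space) measure) = cadlag T"
  unfolding skorokhod_borel_def
  by (rule space_measure_of) (use openin_skorokhod_subset[OF assms] in blast)

lemma measurable_skorokhod_cadlag:
  assumes "0 \<le> T" "Y \<in> M \<rightarrow>\<^sub>M skorokhod_borel T" "\<omega> \<in> space M"
  shows "Y \<omega> \<in> cadlag T"
  using measurable_space[OF assms(2,3)] space_skorokhod_borel[OF assms(1)] by blast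

lemma sets_skorokhod_borel:
  fixes T :: real
  assumes "0 \<le> T"
  shows "sets (skorokhod_borel T :: (real \<Rightarrow> 'a::metric_space) measure) =
    sigma_sets (cadlag T) {U. openin (skorokhod_topology T) U}"
  unfolding skorokhod_borel_def
  by (rule sets_measure_of) (use openin_skorokhod_subset[OF assms] in blast)

lemma openin_skorokhod_ball:
  fixes T :: real and X :: "real \<Rightarrow> 'a::metric_space"
  assumes "0 \<le> T" "X \<in> cadlag T"
  shows "openin (skorokhod_topology T) {Y \<in> cadlag T. skorokhod_dist T Y X < e}"
proof -
  interpret Metric_space "cadlag T :: (real \<Rightarrow> 'a) set" "skorokhod_dist T"
    by (rule Metric_space_skorokhod[OF assms(1)])
  have "mball X e = {Y \<in> cadlag T. skorokhod_dist T Y X < e}"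
    using assms(2) by (auto simp: mball_def commute)
  then show ?thesis
    unfolding skorokhod_topology_def using openin_mball[of X e] by simp
qed

lemma skorokhod_dist_le_uniform:
  assumes "Y \<in> cadlag T" "X \<in> cadlag T" "0 < e" "\<And>t. t \<in> {0..T} \<Longrightarrow> dist (Y t) (X t) \<le> e"
  shows "skorokhod_dist T Y X \<le> e"
  using assms
  by (intro skorokhod_dist_le) (auto simp: skorokhod_close_def intro!: bexI[OF _ time_changes_id])

lemma continuous_imp_cadlag:
  assumes "continuous_on {0..T} f" "f \<in> extensional {0..T}"
  shows "f \<in> cadlag T"
proof -
  have lim: "(f \<longlongrightarrow> f t) (at t within {0..T})" if "t \<in> {0..T}" for t
    using assms(1) that by (simp add: continuous_on_def)
  have "(f \<longlongrightarrow> f t) (at_right t)" if t: "t \<in> {0..<T}" for t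
    using tendsto_within_subset[OF lim[of t], of "{t..T}"] t by (simp add: at_within_Icc_at_right)
  moreover have "(f \<longlongrightarrow> f t) (at_left t)" if t: "t \<in> {0<..T}" for t
    using tendsto_within_subset[OF lim[of t], of "{0..t}"] t by (simp add: at_within_Icc_at_left)
  ultimately show ?thesis using assms(2) unfolding cadlag_def by blast
qed

section \<open>Trajectories as measurable random elements\<close>

lemma nat_floor_eventually_at_right:
  fixes t h :: real
  assumes "0 < h"
  shows "\<forall>\<^sub>F s in at_right t. nat \<lfloor>s / h\<rfloor> = nat \<lfloor>t / h\<rfloor>"
proof -
  have "t < (of_int \<lfloor>t / h\<rfloor> + 1) * h"
    using assms by (simp flip: pos_divide_less_eq)
  moreover have "nat \<lfloor>s / h\<rfloor> = nat \<lfloor>t / h\<rfloor>" if "t < s" "s < (of_int \<lfloor>t / h\<rfloor> + 1) * h" for s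
  proof -
    have "t / h \<le> s / h" using that assms by (simp add: divide_right_mono)
    then have "of_int \<lfloor>t / h\<rfloor> \<le> s / h" by (meson of_int_floor_le order_trans)
    moreover have "s / h < of_int \<lfloor>t / h\<rfloor> + 1" using that assms by (simp add: pos_divide_less_eq)
    ultimately have "\<lfloor>s / h\<rfloor> = \<lfloor>t / h\<rfloor>" by (simp add: floor_eq_iff)
    then show ?thesis by simp
  qed
  ultimately show ?thesis unfolding eventually_at_right_field by blast
qed

text \<open>The ceiling treats both cases at once: at a grid time \<open>t = k * h\<close> the index
  just before is k - 1, and between grid times \<open>\<lceil>t / h\<rceil> - 1\<close> is the
  floor.\<close>

lemma nat_floor_eventually_at_left:
  fixes t h :: real
  assumes "0 < h"
  shows "\<forall>\<^sub>F s in at_left t. nat \<lfloor>s / h\<rfloor> = nat (\<lceil>t / h\<rceil> - 1)"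
proof -
  have "(of_int \<lceil>t / h\<rceil> - 1) * h < t"
    using assms by (simp flip: pos_less_divide_eq) linarith
  moreover have "nat \<lfloor>s / h\<rfloor> = nat (\<lceil>t / h\<rceil> - 1)" if "s < t" "(of_int \<lceil>t / h\<rceil> - 1) * h < s" for s
  proof -
    have "s / h < t / h" using that assms by (simp add: divide_strict_right_mono)
    then have "s / h < of_int \<lceil>t / h\<rceil>" by linarith
    moreover have "of_int \<lceil>t / h\<rceil> - 1 < s / h" using that assms by (simp add: pos_less_divide_eq)
    ultimately have "\<lfloor>s / h\<rfloor> = \<lceil>t / h\<rceil> - 1" by linarith
    then show ?thesis by simp
  qed
  ultimately show ?thesis unfolding eventually_at_left_field by blast
qed

lemma piecewise_trajectory_cadlag:
  fixes x :: "nat \<Rightarrow> 'w \<Rightarrow> 'a::metric_space"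
  assumes "0 < h"
  shows "piecewise_trajectory T h x \<omega> \<in> cadlag T"
proof -
  let ?Y = "piecewise_trajectory T h x \<omega>"
  have "(?Y \<longlongrightarrow> ?Y t) (at_right t)" if t: "t \<in> {0..<T}" for t
  proof (rule tendsto_eventually)
    have "\<forall>\<^sub>F s in at_right t. t < s \<and> s < T"
      using t unfolding eventually_at_right_field by auto
    with nat_floor_eventually_at_right[OF assms, of t]
    show "\<forall>\<^sub>F s in at_right t. ?Y s = ?Y t"
      by eventually_elim (use t in \<open>auto simp: piecewise_trajectory_def\<close>)
  qed
  moreover have "\<exists>l. (?Y \<longlongrightarrow> l) (at_left t)" if t: "t \<in> {0<..T}" for t
  proof (rule exI, rule tendsto_eventually)
    have "\<forall>\<^sub>F s in at_left t. 0 < s \<and> s < t"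
      using t unfolding eventually_at_left_field by auto
    with nat_floor_eventually_at_left[OF assms, of t]
    show "\<forall>\<^sub>F s in at_left t. ?Y s = x (nat (\<lceil>t / h\<rceil> - 1)) \<omega>"
      by eventually_elim (use t in \<open>auto simp: piecewise_trajectory_def\<close>)
  qed
  moreover have "?Y \<in> extensional {0..T}" by (simp add: piecewise_trajectory_def)
  ultimately show ?thesis by (simp add: cadlag_def)
qed

text \<open>The trajectory is a continuous function of the whole sequence of states, for the product
  topology, because only finitely many states are visited up to time \<open>T\<close>.\<close>

lemma piecewise_trajectory_measurable:
  fixes x :: "nat \<Rightarrow> 'w \<Rightarrow> 'a::{metric_space, second_countable_topology}"
  assumes T: "0 \<le> T" and h: "0 < h" and x: "\<And>n. x n \<in> borel_measurable M"
  shows "piecewise_trajectory T h x \<in> M \<rightarrow>\<^sub>M skorokhod_borel T"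
proof -
  let ?\<Phi> = "piecewise_trajectory T h (\<lambda>n s. s n) :: (nat \<Rightarrow> 'a) \<Rightarrow> real \<Rightarrow> 'a"
  have cad: "?\<Phi> s \<in> cadlag T" for s by (rule piecewise_trajectory_cadlag[OF h])
  interpret Metric_space "cadlag T :: (real \<Rightarrow> 'a) set" "skorokhod_dist T"
    by (rule Metric_space_skorokhod[OF T])
  have "open (?\<Phi> -` U)" if U: "openin (skorokhod_topology T) U" for U
    unfolding open_subopen[of "?\<Phi> -` U"]
  proof
    fix s assume "s \<in> ?\<Phi> -` U"
    then obtain e where e: "e > 0" "mball (?\<Phi> s) e \<subseteq> U"
      using U unfolding skorokhod_topology_def openin_mtopology by auto
    define W where "W = (\<Inter>k\<le>nat \<lfloor>T / h\<rfloor>. (\<lambda>s'. s' k) -` ball (s k) (e/2))"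
    have "open W" unfolding W_def
      by (intro open_INT ballI open_vimage open_ball) auto
    moreover have "s \<in> W" using e by (simp add: W_def)
    moreover have "W \<subseteq> ?\<Phi> -` U"
    proof
      fix s' assume s': "s' \<in> W"
      have "dist (?\<Phi> s t) (?\<Phi> s' t) \<le> e/2" if t: "t \<in> {0..T}" for t
      proof -
        have "nat \<lfloor>t / h\<rfloor> \<le> nat \<lfloor>T / h\<rfloor>"
          using t h by (intro nat_mono floor_mono divide_right_mono) auto
        then have "s' (nat \<lfloor>t / h\<rfloor>) \<in> ball (s (nat \<lfloor>t / h\<rfloor>)) (e/2)"
          using s' unfolding W_def by blast
        then show ?thesis using t by (simp add: piecewise_trajectory_def)
      qed
      then have "skorokhod_dist T (?\<Phi> s) (?\<Phi> s') \<le> e/2"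
        using e by (intro skorokhod_dist_le_uniform[OF cad cad]) auto
      then show "s' \<in> ?\<Phi> -` U" using e cad by (auto simp: subset_iff)
    qed
    ultimately show "\<exists>W. open W \<and> s \<in> W \<and> W \<subseteq> ?\<Phi> -` U" by blast
  qed
  then have "?\<Phi> \<in> borel \<rightarrow>\<^sub>M skorokhod_borel T"
    unfolding skorokhod_borel_def
    by (intro measurable_measure_of) (use openin_skorokhod_subset[OF T] cad in auto)
  \<comment> \<open>Coordinatewise measurability suffices: there are countably many coordinates in a
    second countable space, so the Borel sets of the product topology are those of the product
    sigma-algebra.\<close>
  moreover have "(\<lambda>\<omega> n. x n \<omega>) \<in> M \<rightarrow>\<^sub>M borel"
    using x by (intro measurable_coordinatewise_then_product)
  ultimately have "(\<lambda>\<omega>. ?\<Phi> (\<lambda>n. x n \<omega>)) \<in> M \<rightarrow>\<^sub>M skorokhod_borel T"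
    by (rule measurable_compose[rotated])
  then show ?thesis by (simp add: piecewise_trajectory_def[abs_def])
qed

section \<open>Convergence to a deterministic limit\<close>

lemma continuous_map_skorokhod_measurable:
  fixes f :: "(real \<Rightarrow> 'a::metric_space) \<Rightarrow> real"
  assumes T: "0 \<le> T" and f: "continuous_map (skorokhod_topology T) euclideanreal f"
  shows "f \<in> borel_measurable (skorokhod_borel T)"
proof (rule borel_measurableI)
  fix S :: "real set" assume "open S"
  then have "openin (skorokhod_topology T) {Y \<in> cadlag T. f Y \<in> S}"
    using openin_continuous_map_preimage[OF f, of S] topspace_skorokhod[OF T, where 'a='a] by simp
  then have "{Y \<in> cadlag T. f Y \<in> S} \<in> sets (skorokhod_borel T)"
    unfolding sets_skorokhod_borel[OF T] by (intro sigma_sets.Basic) simp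
  moreover have "f -` S \<inter> space (skorokhod_borel T) = {Y \<in> cadlag T. f Y \<in> S}"
    unfolding space_skorokhod_borel[OF T] by auto
  ultimately show "f -` S \<inter> space (skorokhod_borel T) \<in> sets (skorokhod_borel T)" by simp
qed

text \<open>\<open>measure\<close> is 0 on non-measurable sets, so this is what gives the
  probabilities in \<open>converges_in_probability\<close> their meaning.\<close>

lemma skorokhod_ball_event:
  fixes Y :: "'w \<Rightarrow> real \<Rightarrow> 'a::metric_space"
  assumes T: "0 \<le> T" and X: "X \<in> cadlag T" and Y: "Y \<in> M \<rightarrow>\<^sub>M skorokhod_borel T"
  shows "{\<omega> \<in> space M. skorokhod_dist T (Y \<omega>) X < e} \<in> sets M"
proof -
  have "{Z \<in> cadlag T. skorokhod_dist T Z X < e} \<in> sets (skorokhod_borel T)"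
    unfolding sets_skorokhod_borel[OF T] 
    by (intro sigma_sets.Basic) (use openin_skorokhod_ball[OF T X] in simp)
  from measurable_sets[OF Y this]
  have "Y -` {Z \<in> cadlag T. skorokhod_dist T Z X < e} \<inter> space M \<in> sets M" .
  also have "Y -` {Z \<in> cadlag T. skorokhod_dist T Z X < e} \<inter> space M =
      {\<omega> \<in> space M. skorokhod_dist T (Y \<omega>) X < e}"
    using measurable_space[OF Y] unfolding space_skorokhod_borel[OF T] by auto
  finally show ?thesis .
qed

text \<open>With a deterministic limit, continuity of \<open>f\<close> at the single point
  \<open>X\<close> is enough: near \<open>X\<close> the integrand differs from \<open>f X\<close> by
  at most e/2, and elsewhere by at most \<open>2 * B\<close> on an event of vanishing
  probability.\<close>

lemma converges_in_probability_imp_distribution: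
  fixes Y :: "'i \<Rightarrow> 'w \<Rightarrow> real \<Rightarrow> 'a::metric_space"
  assumes T: "0 \<le> T" and X: "X \<in> cadlag T"
    and MY: "\<forall>\<^sub>F h in F. prob_space (M h) \<and> Y h \<in> M h \<rightarrow>\<^sub>M skorokhod_borel T"
    and conv: "converges_in_probability T M Y X F"
  shows "converges_in_distribution T M Y (measure_pmf (return_pmf X)) (\<lambda>Y. Y) F"
  unfolding converges_in_distribution_def
proof (intro allI impI, elim conjE)
  fix f :: "(real \<Rightarrow> 'a) \<Rightarrow> real"
  assume f: "continuous_map (skorokhod_topology T) euclideanreal f" and "bounded (f ` cadlag T)"
  then obtain B where B: "\<And>Z. Z \<in> cadlag T \<Longrightarrow> \<bar>f Z\<bar> \<le> B" by (auto simp: bounded_real)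
  have B0: "0 \<le> B" using B[OF X] by simp
  interpret S: Metric_space "cadlag T :: (real \<Rightarrow> 'a) set" "skorokhod_dist T"
    by (rule Metric_space_skorokhod[OF T])
  have "((\<lambda>h. \<integral>\<omega>. f (Y h \<omega>) \<partial>M h) \<longlongrightarrow> f X) F"
  proof (rule tendstoI)
    fix e :: real assume e: "e > 0"
    have "openin (skorokhod_topology T) {Z \<in> cadlag T. f Z \<in> ball (f X) (e/2)}"
      using openin_continuous_map_preimage[OF f, of "ball (f X) (e/2)"]
        topspace_skorokhod[OF T, where 'a='a] by simp
    then obtain d where d: "d > 0" "\<And>Z. Z \<in> cadlag T \<Longrightarrow> skorokhod_dist T Z X < d \<Longrightarrow> \<bar>f Z - f X\<bar> < e/2"
      using X e unfolding skorokhod_topology_def S.openin_mtopology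
      by (auto simp: dist_real_def subset_iff S.commute abs_minus_commute)
    let ?G = "\<lambda>h. {\<omega> \<in> space (M h). skorokhod_dist T (Y h \<omega>) X < d}"
    \<comment> \<open>Makes \<open>2 * B * c < e/2\<close>; the summand 1 covers
      \<open>B = 0\<close>.\<close>
    define c where "c = e / (4 * (B + 1))"
    have c: "c > 0" "2 * B * c < e/2" using e B0 by (auto simp: c_def field_simps)
    have "((\<lambda>h. measure (M h) (?G h)) \<longlongrightarrow> 1) F"
      using conv d unfolding converges_in_probability_def by blast
    then have "\<forall>\<^sub>F h in F. dist (measure (M h) (?G h)) 1 < c" using c by (intro tendstoD)
    with MY show "\<forall>\<^sub>F h in F. dist (\<integral>\<omega>. f (Y h \<omega>) \<partial>M h) (f X) < e"
    proof eventually_elim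
      fix h assume h: "prob_space (M h) \<and> Y h \<in> M h \<rightarrow>\<^sub>M skorokhod_borel T"
        and close: "dist (measure (M h) (?G h)) 1 < c"
      interpret prob_space "M h" using h by simp
      have G: "?G h \<in> sets (M h)" using skorokhod_ball_event[OF T X] h by blast
      define D where "D = space (M h) - ?G h"
      have D: "D \<in> sets (M h)" using G by (auto simp: D_def)
      then have intD: "integrable (M h) (indicat_real D)"
        by (intro integrable_real_indicator) (auto simp: less_top[symmetric])
      have [measurable]: "(\<lambda>\<omega>. f (Y h \<omega>)) \<in> borel_measurable (M h)"
        using continuous_map_skorokhod_measurable[OF T f] h by (auto intro: measurable_compose)
      have Yc: "Y h \<omega> \<in> cadlag T" if "\<omega> \<in> space (M h)" for \<omega>
        using measurable_skorokhod_cadlag[OF T _ that] h by blast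
      have int: "integrable (M h) (\<lambda>\<omega>. f (Y h \<omega>))"
        by (rule integrable_const_bound[of _ B]) (use B Yc in auto)
      have "\<bar>(\<integral>\<omega>. f (Y h \<omega>) \<partial>M h) - f X\<bar> = \<bar>\<integral>\<omega>. f (Y h \<omega>) - f X \<partial>M h\<bar>"
        using int by (simp add: prob_space)
      also have "\<dots> \<le> (\<integral>\<omega>. \<bar>f (Y h \<omega>) - f X\<bar> \<partial>M h)" by (rule integral_abs_bound)
      also have "\<dots> \<le> (\<integral>\<omega>. e/2 + 2 * B * indicator D \<omega> \<partial>M h)"
      proof (rule integral_mono)
        fix \<omega> assume w: "\<omega> \<in> space (M h)"
        show "\<bar>f (Y h \<omega>) - f X\<bar> \<le> e/2 + 2 * B * indicator D \<omega>"
          using d(2)[OF Yc[OF w]] B[OF Yc[OF w]] B[OF X] w e by (auto simp: indicator_def D_def)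
      qed (use int intD in auto)
      also have "\<dots> = e/2 + 2 * B * prob D"
        using intD D by (subst Bochner_Integration.integral_add) (auto simp: prob_space)
      also have "prob D = 1 - prob (?G h)" unfolding D_def by (rule prob_compl[OF G])
      also have "e/2 + 2 * B * (1 - prob (?G h)) \<le> e/2 + 2 * B * c"
        using close B0 by (intro add_left_mono mult_left_mono) (auto simp: dist_real_def)
      finally show "dist (\<integral>\<omega>. f (Y h \<omega>) \<partial>M h) (f X) < e"
        using c by (simp add: dist_real_def)
    qed
  qed
  then show "((\<lambda>h. \<integral>\<omega>. f (Y h \<omega>) \<partial>M h) \<longlongrightarrow> (\<integral>\<omega>. f \<omega> \<partial>measure_pmf (return_pmf X))) F" by simp
qed

text \<open>Two events of probability above 1/2 must meet, and a trajectory in both lies within e/2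
  of either limit. Nontriviality of \<open>F\<close> turns the eventual bound into a bound.\<close>

lemma converges_in_probability_unique:
  fixes Y :: "'i \<Rightarrow> 'w \<Rightarrow> real \<Rightarrow> 'a::metric_space"
  assumes T: "0 \<le> T" and X: "X \<in> cadlag T" "X' \<in> cadlag T" and F: "F \<noteq> bot"
    and MY: "\<forall>\<^sub>F h in F. prob_space (M h) \<and> Y h \<in> M h \<rightarrow>\<^sub>M skorokhod_borel T"
    and conv: "converges_in_probability T M Y X F" "converges_in_probability T M Y X' F"
  shows "X = X'"
proof -
  interpret S: Metric_space "cadlag T :: (real \<Rightarrow> 'a) set" "skorokhod_dist T"
    by (rule Metric_space_skorokhod[OF T])
  have "skorokhod_dist T X X' \<le> 0 + e" if e: "e > 0" for e
  proof -
    let ?G = "\<lambda>Z h. {\<omega> \<in> space (M h). skorokhod_dist T (Y h \<omega>) Z < e/2}"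
    have "\<forall>\<^sub>F h in F. measure (M h) (?G X h) > 1/2 \<and> measure (M h) (?G X' h) > 1/2"
      using conv[unfolded converges_in_probability_def, rule_format, of "e/2"] e
      by (intro eventually_conj order_tendstoD(1)) auto
    with MY have "\<forall>\<^sub>F h in F. skorokhod_dist T X X' \<le> e"
    proof eventually_elim
      fix h assume h: "prob_space (M h) \<and> Y h \<in> M h \<rightarrow>\<^sub>M skorokhod_borel T"
        and half: "measure (M h) (?G X h) > 1/2 \<and> measure (M h) (?G X' h) > 1/2"
      interpret prob_space "M h" using h by simp
      have G: "?G X h \<in> sets (M h)" "?G X' h \<in> sets (M h)"
        using skorokhod_ball_event[OF T] X h by blast+
      have "?G X h \<inter> ?G X' h \<noteq> {}"
      proof
        assume "?G X h \<inter> ?G X' h = {}"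
        then have "prob (?G X h \<union> ?G X' h) = prob (?G X h) + prob (?G X' h)"
          by (intro finite_measure_Union G)
        then show False using half prob_le_1[of "?G X h \<union> ?G X' h"] by linarith
      qed
      then obtain \<omega> where w: "\<omega> \<in> space (M h)" "skorokhod_dist T (Y h \<omega>) X < e/2"
        "skorokhod_dist T (Y h \<omega>) X' < e/2" by auto
      have "Y h \<omega> \<in> cadlag T"
        using measurable_skorokhod_cadlag[OF T _ w(1)] h by blast
      then have "skorokhod_dist T X X' \<le> skorokhod_dist T X (Y h \<omega>) + skorokhod_dist T (Y h \<omega>) X'"
        using X by (intro S.triangle)
      then show "skorokhod_dist T X X' \<le> e" using w by (simp add: S.commute)
    qed
    then show ?thesis using F by (simp add: eventually_const_iff)
  qed
  then have "skorokhod_dist T X X' \<le> 0" by (rule field_le_epsilon)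
  then show ?thesis using skorokhod_dist_nonneg[of T X X'] X S.zero by (metis order_antisym)
qed

section \<open>One-time and one-step laws of a Markov chain\<close>

text \<open>A \<open>pmf\<close> rather than a measure on \<open>borel\<close>: for kernels of
  finite support all supports stay finite, so every function is integrable.\<close>

primrec chain_law :: "('a \<Rightarrow> 'a pmf) \<Rightarrow> 'a \<Rightarrow> nat \<Rightarrow> 'a pmf" where
  "chain_law K x0 0 = return_pmf x0"
| "chain_law K x0 (Suc n) = bind_pmf (chain_law K x0 n) K"

lemma subalgebra_history:
  assumes x: "\<And>n. x n \<in> borel_measurable M"
  shows "subalgebra M (history M x n)"
proof -
  have m: "(\<lambda>\<omega>. \<lambda>k\<in>{..n}. x k \<omega>) \<in> M \<rightarrow>\<^sub>M (\<Pi>\<^sub>M k\<in>{..n}. borel)"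
    using x by (intro measurable_restrict)
  then have "(\<lambda>\<omega>. \<lambda>k\<in>{..n}. x k \<omega>) \<in> space M \<rightarrow> space (\<Pi>\<^sub>M k\<in>{..n}. borel)"
    unfolding measurable_def by blast
  then show ?thesis
    unfolding subalgebra_def history_def using measurable_sets[OF m]
    by (auto simp: sets_vimage_algebra2)
qed

lemma history_event:
  assumes A: "A \<in> sets borel"
  shows "{\<omega> \<in> space M. x n \<omega> \<in> A} \<in> sets (history M x n)"
proof -
  let ?P = "\<Pi>\<^sub>M k\<in>{..n}. borel"
  have "(\<lambda>g. g n) -` A \<inter> space ?P \<in> sets ?P"
    using measurable_component_singleton[of n "{..n}" "\<lambda>_. borel"] A by (intro measurable_sets) auto
  then have "(\<lambda>\<omega>. \<lambda>k\<in>{..n}. x k \<omega>) -` ((\<lambda>g. g n) -` A \<inter> space ?P) \<inter> space M \<in> sets (history M x n)"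
    unfolding history_def by (rule in_vimage_algebra)
  also have "(\<lambda>\<omega>. \<lambda>k\<in>{..n}. x k \<omega>) -` ((\<lambda>g. g n) -` A \<inter> space ?P) \<inter> space M = {\<omega> \<in> space M. x n \<omega> \<in> A}"
    by (auto simp: space_PiM)
  finally show ?thesis .
qed

text \<open>The conditional expectation is integrated over the event \<open>x n \<in> A\<close> of
  the history. Every later use of the Markov property passes through this joint law of two
  consecutive states.\<close>

lemma markov_chain_transition:
  fixes K :: "'a::topological_space \<Rightarrow> 'a pmf"
  assumes mc: "markov_chain M K x0 x"
    and K: "\<forall>B\<in>sets borel. (\<lambda>y. measure_pmf.prob (K y) B) \<in> borel_measurable borel"
    and A: "A \<in> sets borel" and B: "B \<in> sets borel"
  shows "measure M {\<omega> \<in> space M. x n \<omega> \<in> A \<and> x (Suc n) \<omega> \<in> B} =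
    (\<integral>\<omega>. indicator A (x n \<omega>) * measure_pmf.prob (K (x n \<omega>)) B \<partial>M)"
proof -
  interpret prob_space M using mc by (simp add: markov_chain_def)
  have x[measurable]: "x k \<in> borel_measurable M" for k using mc by (simp add: markov_chain_def)
  note [measurable] = A B K[rule_format, OF B]
  interpret finite_measure_subalgebra M "history M x n"
    by unfold_locales (rule subalgebra_history[OF x])
  let ?I = "\<lambda>\<omega>. indicat_real B (x (Suc n) \<omega>)"
  let ?A = "{\<omega> \<in> space M. x n \<omega> \<in> A}"
  have I: "integrable M ?I" by (rule integrable_const_bound[of _ 1]) auto
  have "measure M {\<omega> \<in> space M. x n \<omega> \<in> A \<and> x (Suc n) \<omega> \<in> B} =
      (\<integral>\<omega>. indicator {\<omega> \<in> space M. x n \<omega> \<in> A \<and> x (Suc n) \<omega> \<in> B} \<omega> \<partial>M)"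
    by simp
  also have "\<dots> = (\<integral>\<omega>\<in>?A. ?I \<omega> \<partial>M)"
    unfolding set_lebesgue_integral_def
    by (rule Bochner_Integration.integral_cong) (auto simp: indicator_def)
  also have "\<dots> = (\<integral>\<omega>\<in>?A. real_cond_exp M (history M x n) ?I \<omega> \<partial>M)"
    by (rule real_cond_exp_intA[OF I history_event[OF A]])
  also have "\<dots> = (\<integral>\<omega>. indicator A (x n \<omega>) * measure_pmf.prob (K (x n \<omega>)) B \<partial>M)"
    unfolding set_lebesgue_integral_def
  proof (rule integral_cong_AE)
    have "AE \<omega> in M. real_cond_exp M (history M x n) ?I \<omega> = measure_pmf.prob (K (x n \<omega>)) B"
      using mc B by (simp add: markov_chain_def)
    then show "AE \<omega> in M. indicat_real ?A \<omega> *\<^sub>R real_cond_exp M (history M x n) ?I \<omega> =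
        indicator A (x n \<omega>) * measure_pmf.prob (K (x n \<omega>)) B"
      using AE_space by eventually_elim (auto simp: indicator_def)
    show "(\<lambda>\<omega>. indicat_real ?A \<omega> *\<^sub>R real_cond_exp M (history M x n) ?I \<omega>) \<in> borel_measurable M"
      using borel_measurable_cond_exp2 by measurable
  qed measurable
  finally show ?thesis .
qed

text \<open>A \<open>pmf\<close> lives on the full power set, so it is pushed to
  \<open>borel\<close> before the comparison. The induction step is
  \<open>markov_chain_transition\<close> with \<open>A = UNIV\<close>.\<close>

lemma markov_chain_law:
  fixes K :: "'a::topological_space \<Rightarrow> 'a pmf"
  assumes mc: "markov_chain M K x0 x"
    and K: "\<forall>B\<in>sets borel. (\<lambda>y. measure_pmf.prob (K y) B) \<in> borel_measurable borel"
  shows "distr M borel (x n) = distr (measure_pmf (chain_law K x0 n)) borel (\<lambda>y. y)"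
proof (induction n)
  interpret prob_space M using mc by (simp add: markov_chain_def)
  have x[measurable]: "x k \<in> borel_measurable M" for k using mc by (simp add: markov_chain_def)
  case 0
  have "AE \<omega> in M. x 0 \<omega> = x0" using mc by (simp add: markov_chain_def)
  then have "distr M borel (x 0) = distr M borel (\<lambda>_. x0)"
    by (intro distr_cong_AE) auto
  also have "\<dots> = distr (measure_pmf (return_pmf x0)) borel (\<lambda>y. y)"
    by (rule measure_eqI) (auto simp: emeasure_distr indicator_def emeasure_space_1)
  finally show ?case by simp
next
  interpret prob_space M using mc by (simp add: markov_chain_def)
  have x[measurable]: "x k \<in> borel_measurable M" for k using mc by (simp add: markov_chain_def)
  case (Suc n)
  show ?case
  proof (rule measure_eqI)
    fix B assume "B \<in> sets (distr M borel (x (Suc n)))"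
    then have B: "B \<in> sets borel" by simp
    note [measurable] = B K[rule_format, OF B]
    have "measure M {\<omega> \<in> space M. x (Suc n) \<omega> \<in> B} = (\<integral>\<omega>. measure_pmf.prob (K (x n \<omega>)) B \<partial>M)"
      using markov_chain_transition[OF mc K, of UNIV B n] B by simp
    also have "\<dots> = (\<integral>y. measure_pmf.prob (K y) B \<partial>distr M borel (x n))"
      by (simp add: integral_distr)
    also have "\<dots> = (\<integral>y. measure_pmf.prob (K y) B \<partial>measure_pmf (chain_law K x0 n))"
      unfolding Suc.IH by (simp add: integral_distr)
    finally have eq: "measure M {\<omega> \<in> space M. x (Suc n) \<omega> \<in> B} = \<dots>" .
    have "emeasure (distr M borel (x (Suc n))) B = ennreal (measure M {\<omega> \<in> space M. x (Suc n) \<omega> \<in> B})"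
      by (simp add: emeasure_distr emeasure_eq_measure vimage_def Int_def conj_commute)
    also have "\<dots> = (\<integral>\<^sup>+y. measure_pmf.prob (K y) B \<partial>measure_pmf (chain_law K x0 n))"
      unfolding eq
      by (intro nn_integral_eq_integral[symmetric] measure_pmf.integrable_const_bound[of _ 1]) auto
    also have "\<dots> = emeasure (distr (measure_pmf (chain_law K x0 (Suc n))) borel (\<lambda>y. y)) B"
      by (simp add: emeasure_distr flip: measure_pmf.emeasure_eq_measure)
    finally show "emeasure (distr M borel (x (Suc n))) B = \<dots>" .
  qed simp
qed

lemma markov_chain_expectation:
  fixes K :: "'a::topological_space \<Rightarrow> 'a pmf" and f :: "'a \<Rightarrow> real"
  assumes mc: "markov_chain M K x0 x"
    and K: "\<forall>B\<in>sets borel. (\<lambda>y. measure_pmf.prob (K y) B) \<in> borel_measurable borel"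
    and [measurable]: "f \<in> borel_measurable borel"
  shows "(\<integral>\<omega>. f (x n \<omega>) \<partial>M) = measure_pmf.expectation (chain_law K x0 n) f"
proof -
  have [measurable]: "x n \<in> borel_measurable M" using mc by (simp add: markov_chain_def)
  have "(\<integral>\<omega>. f (x n \<omega>) \<partial>M) = (\<integral>y. f y \<partial>distr M borel (x n))" by (simp add: integral_distr)
  then show ?thesis unfolding markov_chain_law[OF mc K] by (simp add: integral_distr)
qed

lemma markov_chain_AE_chain_law:
  fixes K :: "'a::t1_space \<Rightarrow> 'a pmf"
  assumes mc: "markov_chain M K x0 x"
    and K: "\<forall>B\<in>sets borel. (\<lambda>y. measure_pmf.prob (K y) B) \<in> borel_measurable borel"
  shows "AE \<omega> in M. x n \<omega> \<in> set_pmf (chain_law K x0 n)"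
proof -
  have [measurable]: "x n \<in> borel_measurable M" using mc by (simp add: markov_chain_def)
  have [measurable]: "set_pmf P \<in> sets borel" for P :: "'a pmf"
    by (rule sets.countable) auto
  have "AE y in distr M borel (x n). y \<in> set_pmf (chain_law K x0 n)"
    unfolding markov_chain_law[OF mc K] by (subst AE_distr_iff) (auto simp: AE_measure_pmf)
  then show ?thesis by (subst (asm) AE_distr_iff) auto
qed

text \<open>The support of \<open>K (x n \<omega>)\<close> varies with the state, while the
  transition law concerns fixed sets. For each fixed state y, leaving the support of
  \<open>K y\<close> from y is a null event; almost surely \<open>x n\<close> takes one of the
  countably many values charged by its law, so countably many null events suffice.\<close>

lemma markov_chain_AE_step:
  fixes K :: "'a::t1_space \<Rightarrow> 'a pmf"
  assumes mc: "markov_chain M K x0 x"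
    and K: "\<forall>B\<in>sets borel. (\<lambda>y. measure_pmf.prob (K y) B) \<in> borel_measurable borel"
  shows "AE \<omega> in M. \<forall>n. x (Suc n) \<omega> \<in> set_pmf (K (x n \<omega>))"
  unfolding AE_all_countable
proof
  interpret prob_space M using mc by (simp add: markov_chain_def)
  have x[measurable]: "x k \<in> borel_measurable M" for k using mc by (simp add: markov_chain_def)
  fix n
  have "AE \<omega> in M. \<not> (x n \<omega> = y \<and> x (Suc n) \<omega> \<notin> set_pmf (K y))" for y
  proof -
    have "set_pmf (K y) \<in> sets borel"
      by (rule sets.countable) auto
    then have B: "- set_pmf (K y) \<in> sets borel"
      by (rule borel_comp)
    have tr: "prob {\<omega> \<in> space M. x n \<omega> \<in> {y} \<and> x (Suc n) \<omega> \<in> - set_pmf (K y)} =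
        (\<integral>\<omega>. indicator {y} (x n \<omega>) * measure_pmf.prob (K (x n \<omega>)) (- set_pmf (K y)) \<partial>M)"
      by (rule markov_chain_transition[OF mc K borel_singleton[OF sets.empty_sets] B])
    have "measure_pmf.prob (K y) (- set_pmf (K y)) = 0"
      by (simp add: measure_pmf_zero_iff)
    then have z0: "indicator {y} z * measure_pmf.prob (K z) (- set_pmf (K y)) = (0::real)" for z
      by (cases "z = y") auto
    have "(\<integral>\<omega>. indicator {y} (x n \<omega>) * measure_pmf.prob (K (x n \<omega>)) (- set_pmf (K y)) \<partial>M) = 0"
      by (simp only: z0) simp
    with tr have "prob {\<omega> \<in> space M. x n \<omega> \<in> {y} \<and> x (Suc n) \<omega> \<in> - set_pmf (K y)} = 0" by (rule trans)
    moreover have "{\<omega> \<in> space M. x n \<omega> \<in> {y} \<and> x (Suc n) \<omega> \<in> - set_pmf (K y)} \<in> sets M"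
      using B measurable_sets[OF x, of "{y}"] measurable_sets[OF x B] by (auto simp: vimage_def Int_def conj_ac intro: sets.sets_Collect_conj)
    ultimately show ?thesis
      by (subst AE_iff_measurable[OF _ refl]) (auto simp: emeasure_eq_measure)
  qed
  then have "AE \<omega> in M. \<forall>y\<in>set_pmf (chain_law K x0 n). \<not> (x n \<omega> = y \<and> x (Suc n) \<omega> \<notin> set_pmf (K y))"
    by (subst AE_ball_countable) auto
  with markov_chain_AE_chain_law[OF mc K, of n]
  show "AE \<omega> in M. x (Suc n) \<omega> \<in> set_pmf (K (x n \<omega>))"
    by eventually_elim auto
qed

section \<open>Global solutions of Lipschitz ODEs\<close>

text \<open>In the exponentially weighted norm \<open>sup\<^sub>t exp (- 2 L t) * norm (X t)\<close> the Picard operator is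
  a contraction with factor \<open>1/2\<close> on the whole interval; \<open>Z t = exp (- 2 L t) * X t\<close> turns this
  norm into the supremum norm.\<close>

lemma lipschitz_ode_solution_exists:
  fixes g :: "'a::euclidean_space \<Rightarrow> 'a"
  assumes T: "0 \<le> T" and g: "L-lipschitz_on UNIV g"
  shows "\<exists>X. X 0 = x0 \<and> (\<forall>t\<in>{0..T}. (X has_vector_derivative g (X t)) (at t within {0..T}))"
proof -
  define M where "M = L + 1"
  have L: "0 \<le> L" using g by (rule lipschitz_on_nonneg)
  have M: "0 < M" using L by (simp add: M_def)
  have gM: "dist (g a) (g b) \<le> M * dist a b" for a b
    using lipschitz_onD[OF g, of a b] by (simp add: M_def distrib_right add_increasing2)
  have g_cont: "continuous_on S g" for S
    using lipschitz_on_continuous_on[OF g] continuous_on_subset by blast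
  define F where "F Z s = g (exp (2 * M * s) *\<^sub>R Z s)" for Z :: "real \<Rightarrow>\<^sub>C 'a" and s
  have F_cont: "continuous_on S (F Z)" for Z S
    unfolding F_def by (intro continuous_on_compose2[OF g_cont] continuous_intros) auto
  have F_int: "F Z integrable_on {0..t}" for Z t
    by (intro integrable_continuous_interval F_cont)
  define P where "P Z t = exp (- (2 * M * t)) *\<^sub>R (x0 + integral {0..t} (F Z))" for Z t
  \<comment> \<open>The fixed point theorem is applied to bounded continuous functions on the whole
    line, whereas \<open>P Z\<close> is controlled on [0,T]; time is therefore clamped to that
    interval.\<close>
  define c where "c = (\<lambda>t::real. max 0 (min T t))"
  have c: "c t \<in> {0..T}" "t \<in> {0..T} \<Longrightarrow> c t = t" for t using T by (auto simp: c_def)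
  have c_cont: "continuous_on UNIV c" unfolding c_def by (intro continuous_intros)
  have P_cont: "continuous_on {0..T} (P Z)" for Z
    unfolding P_def by (intro continuous_intros indefinite_integral_continuous_1 F_int)
  have bc: "(\<lambda>t. P Z (c t)) \<in> bcontfun" for Z
  proof -
    have "bounded (P Z ` {0..T})"
      by (intro compact_imp_bounded compact_continuous_image P_cont) auto
    then have "bounded (range (\<lambda>t. P Z (c t)))"
      by (rule bounded_subset) (use c in auto)
    moreover have "continuous_on UNIV (\<lambda>t. P Z (c t))"
      by (rule continuous_on_compose2[OF P_cont c_cont]) (use c in auto)
    ultimately show ?thesis by (simp add: bcontfun_def)
  qed
  define Q where "Q Z = Bcontfun (\<lambda>t. P Z (c t))" for Z
  have Q: "apply_bcontfun (Q Z) t = P Z (c t)" for Z t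
    unfolding Q_def using Bcontfun_inverse[OF bc] by metis
  have "dist (P Z t) (P W t) \<le> 1/2 * dist Z W" if t: "0 \<le> t" for Z W t
  proof -
    have "norm (integral {0..t} (\<lambda>s. F Z s - F W s)) \<le> integral {0..t} (\<lambda>s. M * exp (2 * M * s) * dist Z W)"
    proof (rule integral_norm_bound_integral)
      fix s assume "s \<in> {0..t}"
      have "norm (F Z s - F W s) \<le> M * dist (exp (2 * M * s) *\<^sub>R Z s) (exp (2 * M * s) *\<^sub>R W s)"
        unfolding F_def using gM by (simp add: dist_norm)
      also have "\<dots> = M * (exp (2 * M * s) * dist (Z s) (W s))"
        by (simp add: dist_norm flip: scaleR_diff_right)
      also have "\<dots> \<le> M * (exp (2 * M * s) * dist Z W)"
        using M by (intro mult_left_mono dist_bounded) auto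
      finally show "norm (F Z s - F W s) \<le> M * exp (2 * M * s) * dist Z W" by (simp add: mult.assoc)
    qed (intro integrable_diff F_int integrable_continuous_interval continuous_intros)+
    \<comment> \<open>The 2 in the exponent of the weight becomes the 1/2 of the primitive, which is
      the contraction factor.\<close>
    also have "((\<lambda>s. M * exp (2 * M * s) * dist Z W) has_integral
        (exp (2 * M * t) / 2 * dist Z W - exp (2 * M * 0) / 2 * dist Z W)) {0..t}"
      by (rule fundamental_theorem_of_calculus[OF t])
        (auto simp flip: has_real_derivative_iff_has_vector_derivative intro!: derivative_eq_intros)
    then have "integral {0..t} (\<lambda>s. M * exp (2 * M * s) * dist Z W) =
        exp (2 * M * t) / 2 * dist Z W - exp (2 * M * 0) / 2 * dist Z W" by (rule integral_unique)
    also have "\<dots> \<le> exp (2 * M * t) / 2 * dist Z W" by simp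
    finally have *: "norm (integral {0..t} (F Z) - integral {0..t} (F W)) \<le> exp (2 * M * t) / 2 * dist Z W"
      by (simp add: Henstock_Kurzweil_Integration.integral_diff[OF F_int F_int])
    have "dist (P Z t) (P W t) = exp (- (2 * M * t)) * norm (integral {0..t} (F Z) - integral {0..t} (F W))"
      by (simp add: P_def dist_norm flip: scaleR_diff_right)
    also have "\<dots> \<le> exp (- (2 * M * t)) * (exp (2 * M * t) / 2 * dist Z W)"
      by (intro mult_left_mono *) auto
    also have "\<dots> = 1/2 * dist Z W" by (simp add: exp_minus)
    finally show ?thesis .
  qed
  then have "dist (Q Z) (Q W) \<le> 1/2 * dist Z W" for Z W
    using c(1) by (intro dist_bound) (auto simp: Q)
  then have "\<exists>!Z. Q Z = Z" by (intro banach_fix_type[of "1/2"]) auto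
  then obtain Z where Z: "Q Z = Z" by blast
  \<comment> \<open>Defined by the Picard integral, so that its derivative is immediate; on [0,T] it
    agrees with the unweighted fixed point.\<close>
  define X where "X t = x0 + integral {0..t} (F Z)" for t
  have "exp (2 * M * t) *\<^sub>R Z t = X t" if "t \<in> {0..T}" for t
  proof -
    have "Z t = P Z t" using Q[of Z t] c(2)[OF that] by (simp add: Z)
    then show ?thesis by (simp add: P_def X_def flip: exp_add)
  qed
  then have FX: "F Z t = g (X t)" if "t \<in> {0..T}" for t using that by (simp add: F_def)
  have "(X has_vector_derivative g (X t)) (at t within {0..T})" if t: "t \<in> {0..T}" for t
    unfolding X_def[abs_def] FX[OF t, symmetric, unfolded X_def]
    using has_vector_derivative_add[OF has_vector_derivative_const integral_has_vector_derivative[OF F_cont t]]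
    by simp
  moreover have "X 0 = x0" by (simp add: X_def)
  ultimately show ?thesis by blast
qed

section \<open>The kernel and the drift of the agent-based model\<close>

definition abm_drift :: "('n \<Rightarrow> 'n \<Rightarrow> real^'n \<Rightarrow> real) \<Rightarrow> real^'n \<Rightarrow> real^'n::finite" where
  "abm_drift p y = (\<chi> i. 1 / real CARD('n) * (\<Sum>j\<in>UNIV. p i j y * (y $ j - y $ i)))"

text \<open>The update is written as a displacement along one axis, so that squared distances expand
  with a single inner product.\<close>

definition interact :: "real \<Rightarrow> 'n \<Rightarrow> 'n \<Rightarrow> real^'n \<Rightarrow> real^'n::finite" where
  "interact \<mu> i j a = a + (\<mu> * (a $ j - a $ i)) *\<^sub>R axis i 1"

lemma interact_eq: "(\<chi> k. if k = i then a $ i + \<mu> * (a $ j - a $ i) else a $ k) = interact \<mu> i j a"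
  by (simp add: interact_def vec_eq_iff axis_def)

lemma set_pmf_abm_kernel:
  "set_pmf (abm_kernel p \<mu> a) \<subseteq> insert a (range (\<lambda>(i, j). interact \<mu> i j a))"
  by (auto simp: abm_kernel_def interact_eq image_iff split: if_splits)

lemma finite_set_pmf_abm_kernel: "finite (set_pmf (abm_kernel p \<mu> (a :: real^'n::finite)))"
  by (rule finite_subset[OF set_pmf_abm_kernel]) simp

lemma expectation_abm_kernel:
  fixes p :: "'n::finite \<Rightarrow> 'n \<Rightarrow> real^'n \<Rightarrow> real" and f :: "real^'n \<Rightarrow> real"
  assumes p: "\<And>i j. p i j a \<in> {0..1}"
  shows "measure_pmf.expectation (abm_kernel p \<mu> a) f =
    (\<Sum>i\<in>UNIV. \<Sum>j\<in>UNIV. p i j a * f (interact \<mu> i j a) + (1 - p i j a) * f a) / (real CARD('n))\<^sup>2"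
proof -
  have inner: "measure_pmf.expectation (bind_pmf (bernoulli_pmf (p i j a))
        (\<lambda>b. return_pmf (if b then interact \<mu> i j a else a))) f =
      p i j a * f (interact \<mu> i j a) + (1 - p i j a) * f a" for i j
    using p[of i j] by (simp flip: map_pmf_def)
  have "measure_pmf.expectation (abm_kernel p \<mu> a) f =
      (\<Sum>(i, j)\<in>UNIV. (p i j a * f (interact \<mu> i j a) + (1 - p i j a) * f a) / real CARD('n \<times> 'n))"
    unfolding abm_kernel_def interact_eq
    by (subst pmf_expectation_bind_pmf_of_set)
      (auto simp: inner divide_inverse mult.commute intro!: sum.cong)
  also have "\<dots> = (\<Sum>(i, j)\<in>UNIV. p i j a * f (interact \<mu> i j a) + (1 - p i j a) * f a) / (real CARD('n))\<^sup>2"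
    by (simp add: sum_divide_distrib case_prod_unfold power2_eq_square)
  also have "(\<Sum>(i, j)\<in>UNIV. p i j a * f (interact \<mu> i j a) + (1 - p i j a) * f a) =
      (\<Sum>i\<in>UNIV. \<Sum>j\<in>UNIV. p i j a * f (interact \<mu> i j a) + (1 - p i j a) * f a)"
    by (simp add: sum.cartesian_product)
  finally show ?thesis .
qed

text \<open>A probability is the expectation of an indicator, and
  \<open>expectation_abm_kernel\<close> makes it a finite sum of measurable functions.\<close>

lemma measurable_abm_kernel:
  fixes p :: "'n::finite \<Rightarrow> 'n \<Rightarrow> real^'n \<Rightarrow> real"
  assumes p: "\<And>i j y. p i j y \<in> {0..1}" and pm: "\<And>i j. continuous_on UNIV (p i j)"
  shows "\<forall>B\<in>sets borel. (\<lambda>y. measure_pmf.prob (abm_kernel p \<mu> y) B) \<in> borel_measurable borel"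
proof
  fix B :: "(real^'n) set" assume [measurable]: "B \<in> sets borel"
  have [measurable]: "p i j \<in> borel_measurable borel" for i j
    using pm by (rule borel_measurable_continuous_onI)
  have [measurable]: "interact \<mu> i j \<in> borel_measurable borel" for i j :: 'n
    unfolding interact_def by (intro borel_measurable_continuous_onI continuous_intros)
  have "measure_pmf.prob (abm_kernel p \<mu> y) B =
      (\<Sum>i\<in>UNIV. \<Sum>j\<in>UNIV. p i j y * indicator B (interact \<mu> i j y) + (1 - p i j y) * indicator B y)
        / (real CARD('n))\<^sup>2" for y
    using expectation_abm_kernel[of p y \<mu> "indicator B", OF p] by simp
  then show "(\<lambda>y. measure_pmf.prob (abm_kernel p \<mu> y) B) \<in> borel_measurable borel" by simp
qed

text \<open>The moved coordinate is a convex combination of two old opinions; this is the source of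
  the later condition \<open>N * h \<le> 1\<close>.\<close>

lemma interact_box:
  assumes "0 \<le> \<mu>" "\<mu> \<le> 1" "\<And>k. \<bar>a $ k\<bar> \<le> R"
  shows "\<bar>interact \<mu> i j a $ k\<bar> \<le> R"
proof (cases "k = i")
  case True
  then have "interact \<mu> i j a $ k = (1 - \<mu>) * a $ i + \<mu> * a $ j"
    by (simp add: interact_def algebra_simps)
  also have "\<bar>\<dots>\<bar> \<le> (1 - \<mu>) * \<bar>a $ i\<bar> + \<mu> * \<bar>a $ j\<bar>"
    using assms abs_triangle_ineq[of "(1 - \<mu>) * a $ i" "\<mu> * a $ j"] by (simp add: abs_mult)
  also have "\<dots> \<le> (1 - \<mu>) * R + \<mu> * R"
    using assms by (intro add_mono mult_left_mono) auto
  finally show ?thesis by (simp add: algebra_simps)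
qed (use assms in \<open>simp add: interact_def axis_def\<close>)

lemma dist_interact_le:
  assumes "0 \<le> \<mu>" "\<And>k. \<bar>a $ k\<bar> \<le> R"
  shows "dist (interact \<mu> i j a) a \<le> 2 * R * \<mu>"
proof -
  have "dist (interact \<mu> i j a) a = \<mu> * \<bar>a $ j - a $ i\<bar>"
    using assms(1) by (simp add: interact_def dist_norm abs_mult)
  also have "\<dots> \<le> \<mu> * (2 * R)"
    using assms(1) assms(2)[of i] assms(2)[of j] by (intro mult_left_mono) auto
  finally show ?thesis by (simp add: mult_ac)
qed

lemma abm_kernel_box:
  assumes "0 \<le> \<mu>" "\<mu> \<le> 1" "\<And>k. \<bar>a $ k\<bar> \<le> R" "b \<in> set_pmf (abm_kernel p \<mu> a)"
  shows "\<bar>b $ k\<bar> \<le> R" and "dist b a \<le> 2 * R * \<mu>"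
proof -
  have "b = a \<or> (\<exists>i j. b = interact \<mu> i j a)" 
    using subsetD[OF set_pmf_abm_kernel assms(4)] by (auto simp: image_iff)
  then show "\<bar>b $ k\<bar> \<le> R" "dist b a \<le> 2 * R * \<mu>"
    using interact_box[OF assms(1-3)] dist_interact_le[OF assms(1,3)] assms(3)[of k] assms(1)
    by auto
qed

text \<open>The squared norm is quadratic, so the expansion has no remainder. In the linear term
  \<open>2 * N * h / N\<^sup>2\<close> meets a sum over j equal to N times the drift, leaving
  \<open>2 * h\<close>; in the quadratic term \<open>(N * h)\<^sup>2\<close> cancels the number of
  pairs.\<close>

lemma expectation_abm_kernel_sq:
  fixes p :: "'n::finite \<Rightarrow> 'n \<Rightarrow> real^'n \<Rightarrow> real"
  assumes p: "\<And>i j. p i j a \<in> {0..1}"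
  shows "measure_pmf.expectation (abm_kernel p (real CARD('n) * h) a) (\<lambda>z. (norm (z - c))\<^sup>2) =
    (norm (a - c))\<^sup>2 + 2 * h * ((a - c) \<bullet> abm_drift p a) +
    h\<^sup>2 * (\<Sum>i\<in>UNIV. \<Sum>j\<in>UNIV. p i j a * (a $ j - a $ i)\<^sup>2)"
proof -
  define N where "N = real CARD('n)"
  have N: "N \<noteq> 0" by (simp add: N_def)
  define d where "d i j = a $ j - a $ i" for i j
  have sq: "(norm (interact \<mu> i j a - c))\<^sup>2 =
      (norm (a - c))\<^sup>2 + (2 * \<mu> * ((a - c) $ i * d i j) + \<mu>\<^sup>2 * (d i j)\<^sup>2)" for \<mu> i j
  proof -
    have eq: "interact \<mu> i j a - c = (a - c) + (\<mu> * d i j) *\<^sub>R axis i 1"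
      by (simp add: interact_def d_def)
    have "(norm (u + w))\<^sup>2 = (norm u)\<^sup>2 + (2 * (u \<bullet> w) + (norm w)\<^sup>2)" for u w :: "real^'n"
      by (simp add: power2_norm_eq_inner inner_add_left inner_add_right inner_commute)
    then show ?thesis
      unfolding eq by (simp add: inner_axis power_mult_distrib mult_ac)
  qed
  have "measure_pmf.expectation (abm_kernel p (N * h) a) (\<lambda>z. (norm (z - c))\<^sup>2) =
      (\<Sum>i\<in>UNIV. \<Sum>j\<in>UNIV. (norm (a - c))\<^sup>2 + 
        (2 * N * h * ((a - c) $ i * (p i j a * d i j)) + N\<^sup>2 * h\<^sup>2 * (p i j a * (d i j)\<^sup>2))) / N\<^sup>2"
    unfolding expectation_abm_kernel[of p a, OF p] sq N_def[symmetric]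
    by (simp add: algebra_simps power_mult_distrib)
  also have "\<dots> = (N\<^sup>2 * (norm (a - c))\<^sup>2 + 2 * N * h * (\<Sum>i\<in>UNIV. (a - c) $ i * (\<Sum>j\<in>UNIV. p i j a * d i j)) +
      N\<^sup>2 * h\<^sup>2 * (\<Sum>i\<in>UNIV. \<Sum>j\<in>UNIV. p i j a * (d i j)\<^sup>2)) / N\<^sup>2"
    by (simp add: sum.distrib sum_distrib_left N_def power2_eq_square mult.assoc)
  also have "(\<Sum>i\<in>UNIV. (a - c) $ i * (\<Sum>j\<in>UNIV. p i j a * d i j)) = N * ((a - c) \<bullet> abm_drift p a)"
    using N by (simp add: inner_vec_def abm_drift_def d_def N_def sum_distrib_left)
  also have "(N\<^sup>2 * (norm (a - c))\<^sup>2 + 2 * N * h * (N * ((a - c) \<bullet> abm_drift p a)) +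
      N\<^sup>2 * h\<^sup>2 * (\<Sum>i\<in>UNIV. \<Sum>j\<in>UNIV. p i j a * (d i j)\<^sup>2)) / N\<^sup>2 =
      (norm (a - c))\<^sup>2 + 2 * h * ((a - c) \<bullet> abm_drift p a) +
      h\<^sup>2 * (\<Sum>i\<in>UNIV. \<Sum>j\<in>UNIV. p i j a * (d i j)\<^sup>2)"
    using N by (simp add: field_simps power2_eq_square)
  finally show ?thesis by (simp add: N_def d_def)
qed

lemma abm_drift_lipschitz:
  fixes p :: "'n::finite \<Rightarrow> 'n \<Rightarrow> real^'n \<Rightarrow> real"
  assumes p: "\<And>i j y. p i j y \<in> {0..1}" and lip: "\<And>i j. \<exists>C. C-lipschitz_on UNIV (p i j)"
    and R: "0 \<le> R"
  shows "\<exists>L. L-lipschitz_on {y. \<forall>k. \<bar>y $ k\<bar> \<le> R} (abm_drift p)"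
proof -
  obtain C where C: "\<And>i j. (C i j)-lipschitz_on UNIV (p i j)" using lip by metis
  have C0: "0 \<le> C i j" for i j using C by (rule lipschitz_on_nonneg)
  \<comment> \<open>By the product rule: 2 from the two coordinate differences, weighted by
    \<open>p i j \<le> 1\<close>, and \<open>2 * R * C i j\<close> from the variation of
    \<open>p i j\<close> times a difference of opinions in the box.\<close>
  let ?L = "\<Sum>i\<in>UNIV. \<Sum>j\<in>UNIV. 2 + 2 * R * C i j"
  have "norm (abm_drift p y - abm_drift p z) \<le> ?L * norm (y - z)"
    if y: "\<And>k. \<bar>y $ k\<bar> \<le> R" and z: "\<And>k. \<bar>z $ k\<bar> \<le> R" for y z
  proof -
    have term_le: "\<bar>p i j y * (y $ j - y $ i) - p i j z * (z $ j - z $ i)\<bar> \<le> (2 + 2 * R * C i j) * norm (y - z)" for i j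
    proof -
      have "p i j y * (y $ j - y $ i) - p i j z * (z $ j - z $ i) =
          p i j y * ((y - z) $ j - (y - z) $ i) + (p i j y - p i j z) * (z $ j - z $ i)"
        by (simp add: algebra_simps)
      also have "\<bar>\<dots>\<bar> \<le> p i j y * \<bar>(y - z) $ j - (y - z) $ i\<bar> + \<bar>p i j y - p i j z\<bar> * \<bar>z $ j - z $ i\<bar>"
        using p[of i j y] by (intro order_trans[OF abs_triangle_ineq]) (simp add: abs_mult)
      also have "\<dots> \<le> 1 * (2 * norm (y - z)) + (C i j * norm (y - z)) * (2 * R)"
      proof (intro add_mono mult_mono)
        show "\<bar>(y - z) $ j - (y - z) $ i\<bar> \<le> 2 * norm (y - z)"
          using component_le_norm_cart[of "y - z" i] component_le_norm_cart[of "y - z" j] by linarith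
        show "\<bar>p i j y - p i j z\<bar> \<le> C i j * norm (y - z)"
          using lipschitz_onD[OF C[of i j], of y z] by (simp add: dist_norm)
        show "\<bar>z $ j - z $ i\<bar> \<le> 2 * R" using z[of i] z[of j] by linarith
      qed (use p C0 in auto)
      finally show ?thesis by (simp add: algebra_simps)
    qed
    have "\<bar>(abm_drift p y - abm_drift p z) $ i\<bar> \<le> (\<Sum>j\<in>UNIV. (2 + 2 * R * C i j) * norm (y - z))" for i
    proof -
      have "(abm_drift p y - abm_drift p z) $ i =
          (\<Sum>j\<in>UNIV. p i j y * (y $ j - y $ i) - p i j z * (z $ j - z $ i)) / real CARD('n)"
        by (simp add: abm_drift_def sum_subtractf diff_divide_distrib)
      also have "\<bar>\<dots>\<bar> \<le> \<bar>\<Sum>j\<in>UNIV. p i j y * (y $ j - y $ i) - p i j z * (z $ j - z $ i)\<bar>"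
        by (simp add: abs_divide divide_le_eq mult_left_le_one_le)
          (use mult_left_mono[of 1 "real CARD('n)"] in fastforce)
      also have "\<dots> \<le> (\<Sum>j\<in>UNIV. (2 + 2 * R * C i j) * norm (y - z))"
        by (intro sum_abs[THEN order_trans] sum_mono term_le)
      finally show ?thesis .
    qed
    then have "norm (abm_drift p y - abm_drift p z) \<le> (\<Sum>i\<in>UNIV. \<Sum>j\<in>UNIV. (2 + 2 * R * C i j) * norm (y - z))"
      by (intro norm_le_l1_cart[THEN order_trans] sum_mono)
    then show ?thesis by (simp add: sum_distrib_right)
  qed
  then have "?L-lipschitz_on {y. \<forall>k. \<bar>y $ k\<bar> \<le> R} (abm_drift p)"
    using R C0 by (intro lipschitz_onI) (auto simp: dist_norm intro!: sum_nonneg)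
  then show ?thesis by blast
qed

section \<open>Existence for the ODE and invariance of the box\<close>

lemma abm_ode_solution_iff:
  fixes p :: "'n::finite \<Rightarrow> 'n \<Rightarrow> real^'n \<Rightarrow> real"
  shows "abm_ode_solution p T x0 X \<longleftrightarrow> X \<in> extensional {0..T} \<and> X 0 = x0 \<and>
    (\<forall>t\<in>{0..T}. (X has_vector_derivative abm_drift p (X t)) (at t within {0..T}))"
proof -
  have "(X has_vector_derivative v) (at t within S) \<longleftrightarrow>
      (\<forall>i. ((\<lambda>s. X s $ i) has_real_derivative v $ i) (at t within S))" for t S and v :: "real^'n"
    unfolding has_real_derivative_iff_has_vector_derivative has_vector_derivative_def
    by (subst has_derivative_componentwise_within) (auto simp: Basis_vec_def inner_axis)
  then show ?thesis by (simp add: abm_ode_solution_def abm_drift_def)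
qed

text \<open>If u exceeded R at t, then after the last earlier time s with \<open>u s \<le> R\<close>
  it would stay above R and hence be nonincreasing, giving
  \<open>u t \<le> u s \<le> R\<close>.\<close>

lemma derivative_barrier:
  fixes u :: "real \<Rightarrow> real"
  assumes u: "\<And>t. t \<in> {0..T} \<Longrightarrow> (u has_real_derivative u' t) (at t within {0..T})"
    and u0: "u 0 \<le> R" and bar: "\<And>t. t \<in> {0..T} \<Longrightarrow> R < u t \<Longrightarrow> u' t \<le> 0"
    and t: "t \<in> {0..T}"
  shows "u t \<le> R"
proof (rule ccontr)
  assume "\<not> u t \<le> R"
  have cont: "continuous_on {0..T} u"
    by (rule DERIV_continuous_on[OF u])
  define S where "S = {s \<in> {0..t}. u s \<le> R}"
  have "closed ({0..t} \<inter> u -` {..R})"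
    using t by (intro continuous_closed_preimage continuous_on_subset[OF cont]) auto
  moreover have "S = {0..t} \<inter> u -` {..R}" by (auto simp: S_def)
  ultimately have S: "closed S" "S \<noteq> {}" "bdd_above S"
    using t u0 by (auto intro!: bdd_aboveI[of _ t] exI[of _ 0])
  define s where "s = Sup S"
  have s: "s \<in> S" unfolding s_def using S closed_contains_Sup by blast
  then have st: "0 \<le> s" "s < t" "u s \<le> R" using \<open>\<not> u t \<le> R\<close> by (auto simp: S_def less_le)
  have above: "R < u r" if "s < r" "r \<le> t" for r
    using cSup_upper[OF _ S(3), of r] that st unfolding s_def[symmetric] by (fastforce simp: S_def)
  have "u t \<le> u s"
  proof (rule DERIV_nonpos_imp_decreasing_open[where f = u])
    fix r assume r: "s < r" "r < t"
    have "at r within {0..T} = at r" using r st t by (intro at_within_interior) auto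
    then show "\<exists>y. (u has_real_derivative y) (at r) \<and> y \<le> 0"
      using u[of r] bar[of r] above[of r] r st t by auto
  qed (use st t in \<open>auto intro: continuous_on_subset[OF cont]\<close>)
  then show False using st \<open>\<not> u t \<le> R\<close> by simp
qed

definition clip :: "real \<Rightarrow> real^'n \<Rightarrow> real^'n" where
  "clip R y = (\<chi> i. max (- R) (min R (y $ i)))"

lemma clip_box: "0 \<le> R \<Longrightarrow> \<bar>clip R y $ i\<bar> \<le> R"
  by (auto simp: clip_def)

lemma clip_id: "(\<And>i. \<bar>y $ i\<bar> \<le> R) \<Longrightarrow> clip R y = y"
  by (simp add: clip_def vec_eq_iff abs_le_iff minus_le_iff)

lemma clip_lipschitz: "1-lipschitz_on UNIV (clip R :: real^'n::finite \<Rightarrow> real^'n)"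
proof (rule lipschitz_onI)
  fix y z :: "real^'n"
  have "norm (clip R y - clip R z) \<le> norm (y - z)"
    by (rule norm_le_componentwise_cart) (auto simp: clip_def max_def min_def)
  then show "dist (clip R y) (clip R z) \<le> 1 * dist y z" by (simp add: dist_norm)
qed simp

text \<open>The clipped drift is globally Lipschitz. Its solution is kept in the box by the barrier
  argument for each coordinate and its negative, and inside the box clipping changes
  nothing.\<close>

lemma abm_ode_solution_exists:
  fixes p :: "'n::finite \<Rightarrow> 'n \<Rightarrow> real^'n \<Rightarrow> real"
  assumes T: "0 \<le> T" and p: "\<And>i j y. p i j y \<in> {0..1}" and lip: "\<And>i j. \<exists>C. C-lipschitz_on UNIV (p i j)"
  shows "\<exists>X. abm_ode_solution p T x0 X"
proof -
  define R where "R = norm x0"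
  have R: "0 \<le> R" "\<bar>x0 $ i\<bar> \<le> R" for i by (simp_all add: R_def component_le_norm_cart)
  define g where "g y = abm_drift p (clip R y)" for y
  obtain L where L: "L-lipschitz_on {y. \<forall>k. \<bar>y $ k\<bar> \<le> R} (abm_drift p)"
    using abm_drift_lipschitz[of p R, OF p lip R(1)] by blast
  have "(L * 1)-lipschitz_on UNIV g" unfolding g_def
    by (rule lipschitz_on_compose2[OF clip_lipschitz])
      (rule lipschitz_on_subset[OF L], use clip_box[OF R(1)] in auto)
  then obtain X where X: "X 0 = x0"
    "\<And>t. t \<in> {0..T} \<Longrightarrow> (X has_vector_derivative g (X t)) (at t within {0..T})"
    using lipschitz_ode_solution_exists[OF T] by blast
  have Xi: "((\<lambda>s. X s $ i) has_real_derivative g (X t) $ i) (at t within {0..T})" if "t \<in> {0..T}" for t i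
    unfolding has_real_derivative_iff_has_vector_derivative
    using bounded_linear.has_vector_derivative[OF bounded_linear_vec_nth X(2)[OF that]] .
  \<comment> \<open>Beyond the face the clipped coordinate i equals R, the largest possible value,
    so no difference with another coordinate is positive.\<close>
  have upper: "g y $ i \<le> 0" if "R < y $ i" for y i
  proof -
    have "p i j (clip R y) * (clip R y $ j - clip R y $ i) \<le> 0" for j
      using that R(1) p[of i j "clip R y"] by (intro mult_nonneg_nonpos) (auto simp: clip_def)
    then show ?thesis unfolding g_def abm_drift_def
      by (simp add: sum_nonpos divide_nonpos_nonneg)
  qed
  have lower: "0 \<le> g y $ i" if "y $ i < - R" for y i
  proof -
    have "0 \<le> p i j (clip R y) * (clip R y $ j - clip R y $ i)" for j
      using that R(1) p[of i j "clip R y"] by (intro mult_nonneg_nonneg) (auto simp: clip_def)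
    then show ?thesis unfolding g_def abm_drift_def
      by (simp add: sum_nonneg)
  qed
  have "X t $ i \<le> R" if "t \<in> {0..T}" for t i
    by (rule derivative_barrier[OF Xi _ _ that]) (use X(1) R(2)[of i] upper in \<open>auto simp: abs_le_iff\<close>)
  moreover have "- X t $ i \<le> R" if "t \<in> {0..T}" for t i
    by (rule derivative_barrier[OF DERIV_minus[OF Xi] _ _ that])
      (use X(1) R(2)[of i] lower in \<open>auto simp: abs_le_iff\<close>)
  ultimately have box: "g (X t) = abm_drift p (X t)" if "t \<in> {0..T}" for t
    using that by (simp add: g_def clip_id abs_le_iff)
  have "abm_ode_solution p T x0 (restrict X {0..T})"
    unfolding abm_ode_solution_iff
  proof (intro conjI ballI)
    show "restrict X {0..T} 0 = x0" using T X(1) by simp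
    fix t assume t: "t \<in> {0..T}"
    then show "(restrict X {0..T} has_vector_derivative abm_drift p (restrict X {0..T} t)) (at t within {0..T})"
      using X(2)[OF t] box[OF t] has_vector_derivative_transform[OF t, of "restrict X {0..T}" X "g (X t)"] by simp
  qed simp
  then show ?thesis by blast
qed

section \<open>Comparison of the chain with the ODE\<close>

lemma expectation_bind_pmf_finite:
  fixes f :: "'b \<Rightarrow> real"
  assumes "finite (set_pmf P)" "\<And>a. a \<in> set_pmf P \<Longrightarrow> finite (set_pmf (K a))"
  shows "measure_pmf.expectation (bind_pmf P K) f =
    measure_pmf.expectation P (\<lambda>a. measure_pmf.expectation (K a) f)"
proof -
  have "measure_pmf.expectation P (\<lambda>a. measure_pmf.expectation (K a) f) =
      (\<Sum>a\<in>set_pmf P. pmf P a *\<^sub>R measure_pmf.expectation (K a) f)"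
    by (intro integral_measure_pmf assms) auto
  then show ?thesis
    using pmf_expectation_bind[OF assms order_refl, where h = f] by simp
qed

lemma abm_ode_solution_cadlag:
  assumes "abm_ode_solution p T x0 X"
  shows "X \<in> cadlag T"
proof (rule continuous_imp_cadlag)
  show "continuous_on {0..T} X"
    using assms by (intro continuous_on_vector_derivative[where f' = "\<lambda>t. abm_drift p (X t)"])
      (auto simp: abm_ode_solution_iff)
qed (use assms in \<open>simp add: abm_ode_solution_def\<close>)

text \<open>\<open>R\<close> bounds the whole given solution. Since \<open>x0 = X 0\<close>, the
  same box contains the start of the chain and, for small h, all its later states.\<close>

locale abm_limit =
  fixes p :: "'n::finite \<Rightarrow> 'n \<Rightarrow> real^'n \<Rightarrow> real" and T :: real and x0 :: "real^'n"
    and X :: "real \<Rightarrow> real^'n" and R L N :: real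
  assumes N: "N = real CARD('n)"
    and T: "0 \<le> T"
    and p: "\<And>i j y. p i j y \<in> {0..1}"
    and p_cont: "\<And>i j. continuous_on UNIV (p i j)"
    and L: "L-lipschitz_on {y. \<forall>k. \<bar>y $ k\<bar> \<le> R} (abm_drift p)"
    and X: "abm_ode_solution p T x0 X"
    and X_box: "\<And>t k. t \<in> {0..T} \<Longrightarrow> \<bar>X t $ k\<bar> \<le> R"
begin

abbreviation step_law :: "real \<Rightarrow> real^'n \<Rightarrow> (real^'n) pmf" where
  "step_law h \<equiv> abm_kernel p (N * h)"
abbreviation law :: "real \<Rightarrow> nat \<Rightarrow> (real^'n) pmf" where
  "law h \<equiv> chain_law (step_law h) x0"

text \<open>A bound for the drift on the box, hence for the speed of \<open>X\<close>: the drift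
  vanishes at 0 and \<open>N * R\<close> bounds the norm.\<close>

definition B where "B = L * (N * R)"

lemma N0: "0 < N" by (simp add: N)

lemma L0: "0 \<le> L" using L by (rule lipschitz_on_nonneg)

lemma X0: "X 0 = x0" using X by (simp add: abm_ode_solution_def)

lemma x0_box: "\<bar>x0 $ k\<bar> \<le> R" using X_box[of 0 k] T X0 by simp

lemma R0: "0 \<le> R" using x0_box[of undefined] by linarith

lemma norm_box: "(\<And>k. \<bar>y $ k\<bar> \<le> R) \<Longrightarrow> norm (y :: real^'n) \<le> N * R"
  unfolding N using norm_le_l1_cart[of y] sum_bounded_above[of UNIV "\<lambda>k. \<bar>y $ k\<bar>" R] by simp

lemma drift_bound:
  assumes "\<And>k. \<bar>y $ k\<bar> \<le> R"
  shows "norm (abm_drift p y) \<le> B"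
proof -
  have "abm_drift p 0 = 0" by (simp add: abm_drift_def vec_eq_iff)
  then have "norm (abm_drift p y) \<le> L * norm y"
    using lipschitz_onD[OF L, of y 0] assms R0 by simp
  also have "\<dots> \<le> B" unfolding B_def using norm_box[OF assms] L0 by (rule mult_left_mono)
  finally show ?thesis .
qed

lemma B0: "0 \<le> B" using drift_bound[OF x0_box] norm_ge_zero order_trans by blast

lemma X_deriv: "t \<in> {0..T} \<Longrightarrow> (X has_vector_derivative abm_drift p (X t)) (at t within {0..T})"
  using X by (simp add: abm_ode_solution_iff)

lemma X_lipschitz:
  assumes "s \<in> {0..T}" "t \<in> {0..T}"
  shows "dist (X s) (X t) \<le> B * \<bar>s - t\<bar>"
proof -
  have "norm (X s - X t) \<le> B * norm (s - t)"
  proof (rule differentiable_bound[where S = "{0..T}" and f' = "\<lambda>r v. v *\<^sub>R abm_drift p (X r)"])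
    fix r assume r: "r \<in> {0..T}"
    show "(X has_derivative (\<lambda>v. v *\<^sub>R abm_drift p (X r))) (at r within {0..T})"
      using X_deriv[OF r] by (simp add: has_vector_derivative_def)
    show "onorm (\<lambda>v. v *\<^sub>R abm_drift p (X r)) \<le> B"
      using drift_bound[OF X_box[OF r]] B0
      by (intro onorm_bound) (auto simp: mult.commute[of B] intro!: mult_left_mono)
  qed (use assms in auto)
  then show ?thesis by (simp add: dist_norm)
qed

text \<open>The Euler error: after subtracting the motion with frozen drift, the remaining velocity
  is at most L times the distance \<open>B * h\<close> travelled.\<close>

lemma X_taylor:
  assumes "0 \<le> t" "0 \<le> h" "t + h \<le> T"
  shows "norm (X (t + h) - X t - h *\<^sub>R abm_drift p (X t)) \<le> L * B * h\<^sup>2"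
proof -
  let ?f = "\<lambda>s. X s - s *\<^sub>R abm_drift p (X t)"
  have "norm (?f (t + h) - ?f t) \<le> (L * B * h) * norm (t + h - t)"
  proof (rule differentiable_bound[where S = "{t..t + h}" and
        f' = "\<lambda>r v. v *\<^sub>R (abm_drift p (X r) - abm_drift p (X t))"])
    fix r assume r: "r \<in> {t..t + h}"
    then have r': "r \<in> {0..T}" and t: "t \<in> {0..T}" using assms by auto
    have "(X has_vector_derivative abm_drift p (X r)) (at r within {t..t + h})"
      by (rule has_vector_derivative_within_subset[OF X_deriv[OF r']]) (use assms in auto)
    then have "(?f has_vector_derivative (abm_drift p (X r) - 1 *\<^sub>R abm_drift p (X t))) (at r within {t..t + h})"
      by (auto intro!: derivative_eq_intros)
    then show "(?f has_derivative (\<lambda>v. v *\<^sub>R (abm_drift p (X r) - abm_drift p (X t)))) (at r within {t..t + h})"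
      by (simp add: has_vector_derivative_def)
    have "dist (abm_drift p (X r)) (abm_drift p (X t)) \<le> L * dist (X r) (X t)"
      using X_box[OF r'] X_box[OF t] by (intro lipschitz_onD[OF L]) auto
    also have "\<dots> \<le> L * (B * \<bar>r - t\<bar>)"
      using X_lipschitz[OF r' t] L0 by (rule mult_left_mono)
    also have "\<dots> \<le> L * (B * h)"
      using L0 B0 r by (intro mult_left_mono) auto
    finally have "norm (abm_drift p (X r) - abm_drift p (X t)) \<le> L * B * h" by (simp add: dist_norm)
    then show "onorm (\<lambda>v. v *\<^sub>R (abm_drift p (X r) - abm_drift p (X t))) \<le> L * B * h"
      using L0 B0 assms
      by (intro onorm_bound) (auto simp: mult.commute[of "L * B * h"] intro!: mult_left_mono)
  qed (use assms in auto)
  then show ?thesis using assms by (simp add: power2_eq_square algebra_simps)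
qed

section \<open>Second-moment estimate at a fixed time\<close>

text \<open>Coefficients of h^2 in one step, in order: error times Euler remainder, squared
  increment of \<open>X\<close>, increment of \<open>X\<close> times drift of the chain, and the
  noise of N^2 pairs with differences at most \<open>2 * R\<close>.\<close>

definition C where "C = 4 * N * R * (L * B) + (B + L * B)\<^sup>2 + 2 * B * (B + L * B) + 4 * R\<^sup>2 * N\<^sup>2"

lemma C0: "0 \<le> C" using L0 B0 R0 N0 by (simp add: C_def)

text \<open>The first-order terms pair the error with the difference of the drifts at
  \<open>a\<close> and \<open>X t\<close>, so the Lipschitz bound gives the factor
  \<open>1 + 2 * L * h\<close>. All other terms are of order h^2.\<close>

lemma second_moment_step:
  assumes h: "0 \<le> h" "h \<le> 1" and t: "0 \<le> t" "t + h \<le> T" and a: "\<And>k. \<bar>a $ k\<bar> \<le> R"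
  shows "measure_pmf.expectation (step_law h a) (\<lambda>z. (norm (z - X (t + h)))\<^sup>2) \<le>
    (1 + 2 * L * h) * (norm (a - X t))\<^sup>2 + C * h\<^sup>2"
proof -
  define b where "b = abm_drift p"
  define D where "D = L * B"
  define e where "e = a - X t"
  \<comment> \<open>\<open>r\<close> is the Euler remainder and \<open>\<delta>\<close> the full
    increment of the ODE solution over one step.\<close>
  define r where "r = X (t + h) - X t - h *\<^sub>R b (X t)"
  define \<delta> where "\<delta> = h *\<^sub>R b (X t) + r"
  have D0: "0 \<le> D" using L0 B0 by (simp add: D_def)
  have t': "t \<in> {0..T}" using t h by auto
  have r: "norm r \<le> D * h\<^sup>2" using X_taylor[of t h] t h by (simp add: r_def b_def D_def)
  have hh: "h\<^sup>2 \<le> h" using h by (simp add: power2_eq_square mult_left_le)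
  have "norm \<delta> \<le> h * norm (b (X t)) + norm r"
    unfolding \<delta>_def using norm_triangle_ineq[of "h *\<^sub>R b (X t)" r] h by simp
  also have "\<dots> \<le> h * B + D * h"
    using drift_bound[OF X_box[OF t']] h r mult_left_mono[OF hh D0]
    by (intro add_mono mult_left_mono) (auto simp: b_def)
  finally have \<delta>: "norm \<delta> \<le> h * (B + D)" by (simp add: algebra_simps)
  have e: "norm e \<le> 2 * (N * R)"
    using norm_triangle_ineq4[of a "X t"] norm_box[OF a] norm_box[of "X t", OF X_box[OF t']]
    by (simp add: e_def)
  have ba: "norm (b a) \<le> B" using drift_bound[OF a] by (simp add: b_def)
  have "a - X (t + h) = e - \<delta>" by (simp add: e_def \<delta>_def r_def)
  then have "measure_pmf.expectation (step_law h a) (\<lambda>z. (norm (z - X (t + h)))\<^sup>2) =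
      (norm (e - \<delta>))\<^sup>2 + 2 * h * ((e - \<delta>) \<bullet> b a) +
      h\<^sup>2 * (\<Sum>i\<in>UNIV. \<Sum>j\<in>UNIV. p i j a * (a $ j - a $ i)\<^sup>2)"
    using expectation_abm_kernel_sq[of p a h "X (t + h)", OF p] by (simp add: b_def N)
  also have "(norm (e - \<delta>))\<^sup>2 + 2 * h * ((e - \<delta>) \<bullet> b a) =
      (norm e)\<^sup>2 + 2 * h * (e \<bullet> (b a - b (X t))) - 2 * (e \<bullet> r) + (norm \<delta>)\<^sup>2 - 2 * h * (\<delta> \<bullet> b a)"
  proof -
    have "(norm (e - \<delta>))\<^sup>2 = (norm e)\<^sup>2 - 2 * (e \<bullet> \<delta>) + (norm \<delta>)\<^sup>2"
      by (simp add: power2_norm_eq_inner inner_diff_left inner_diff_right inner_commute)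
    moreover have "e \<bullet> \<delta> = h * (e \<bullet> b (X t)) + e \<bullet> r" by (simp add: \<delta>_def inner_add_right)
    ultimately show ?thesis by (simp add: inner_diff_left inner_diff_right algebra_simps)
  qed
  also have "\<dots> + h\<^sup>2 * (\<Sum>i\<in>UNIV. \<Sum>j\<in>UNIV. p i j a * (a $ j - a $ i)\<^sup>2) \<le>
      ((norm e)\<^sup>2 + 2 * h * (L * (norm e)\<^sup>2) + 2 * (2 * (N * R) * (D * h\<^sup>2)) + (h * (B + D))\<^sup>2 + 2 * h * (h * (B + D) * B))
      + h\<^sup>2 * (4 * R\<^sup>2 * N\<^sup>2)"
  proof (intro add_mono mult_left_mono)
    have "e \<bullet> (b a - b (X t)) \<le> norm e * norm (b a - b (X t))" by (rule norm_cauchy_schwarz)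
    also have "\<dots> \<le> norm e * (L * norm e)"
      using lipschitz_onD[OF L, of a "X t"] a X_box[OF t']
      by (intro mult_left_mono) (auto simp: b_def e_def dist_norm)
    finally have 1: "e \<bullet> (b a - b (X t)) \<le> L * (norm e)\<^sup>2"
      by (simp add: power2_eq_square mult_ac)
    have "\<bar>e \<bullet> r\<bar> \<le> norm e * norm r" by (rule Cauchy_Schwarz_ineq2)
    also have "\<dots> \<le> 2 * (N * R) * (D * h\<^sup>2)" using e r by (intro mult_mono) (use R0 N0 in auto)
    finally have 2: "- (e \<bullet> r) \<le> 2 * (N * R) * (D * h\<^sup>2)" by linarith
    have "\<bar>\<delta> \<bullet> b a\<bar> \<le> norm \<delta> * norm (b a)" by (rule Cauchy_Schwarz_ineq2)
    also have "\<dots> \<le> h * (B + D) * B" using \<delta> ba h B0 D0 by (intro mult_mono) auto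
    finally have 3: "- (\<delta> \<bullet> b a) \<le> h * (B + D) * B" by linarith
    have h2: "0 \<le> 2 * h" using h by simp
    have h3: "- (2 * h * (\<delta> \<bullet> b a)) \<le> 2 * h * (h * (B + D) * B)"
      using mult_left_mono[OF 3 h2] by (simp only: mult_minus_right)
    have 4: "(norm \<delta>)\<^sup>2 \<le> (h * (B + D))\<^sup>2" using \<delta> by (intro power_mono) auto
    show "(norm e)\<^sup>2 + 2 * h * (e \<bullet> (b a - b (X t))) - 2 * (e \<bullet> r) + (norm \<delta>)\<^sup>2 - 2 * h * (\<delta> \<bullet> b a) \<le>
        (norm e)\<^sup>2 + 2 * h * (L * (norm e)\<^sup>2) + 2 * (2 * (N * R) * (D * h\<^sup>2)) + (h * (B + D))\<^sup>2 + 2 * h * (h * (B + D) * B)"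
      using mult_left_mono[OF 1 h2] 2 h3 4 by linarith
    have "p i j a * (a $ j - a $ i)\<^sup>2 \<le> 1 * (2 * R)\<^sup>2" for i j
      using p[of i j a] a[of i] a[of j] by (intro mult_mono abs_le_square_iff[THEN iffD1]) auto
    then have "(\<Sum>i\<in>(UNIV::'n set). \<Sum>j\<in>(UNIV::'n set). p i j a * (a $ j - a $ i)\<^sup>2) \<le>
        (\<Sum>i\<in>(UNIV::'n set). \<Sum>j\<in>(UNIV::'n set). 1 * (2 * R)\<^sup>2)"
      by (intro sum_mono)
    then show "(\<Sum>i\<in>UNIV. \<Sum>j\<in>UNIV. p i j a * (a $ j - a $ i)\<^sup>2) \<le> 4 * R\<^sup>2 * N\<^sup>2"
      by (simp add: N power2_eq_square mult_ac)
  qed (use h in auto)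
  also have "\<dots> = (1 + 2 * L * h) * (norm e)\<^sup>2 + C * h\<^sup>2"
    by (simp add: C_def D_def power2_eq_square algebra_simps)
  finally show ?thesis by (simp add: e_def)
qed

lemma law_box:
  assumes h: "0 \<le> h" "N * h \<le> 1"
  shows "y \<in> set_pmf (law h n) \<Longrightarrow> \<bar>y $ k\<bar> \<le> R"
proof (induction n arbitrary: y k)
  case 0
  then show ?case by (simp add: x0_box)
next
  case (Suc n)
  then obtain a where a: "a \<in> set_pmf (law h n)" "y \<in> set_pmf (step_law h a)" by auto
  show ?case by (rule abm_kernel_box(1)[OF _ h(2) Suc.IH[OF a(1)] a(2)]) (use h N0 in simp)
qed

lemma finite_law: "finite (set_pmf (law h n))"
  by (induction n) (auto simp: finite_set_pmf_abm_kernel)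

text \<open>Discrete Gronwall. As \<open>q \<ge> 1\<close>, each new error d may be enlarged to
  \<open>d * q ^ Suc n\<close>, which closes the induction without a geometric sum or a division by
  \<open>L\<close>, which may be 0.\<close>

lemma second_moment:
  assumes h: "0 \<le> h" "h \<le> 1" "N * h \<le> 1"
  shows "real n * h \<le> T \<Longrightarrow> measure_pmf.expectation (law h n) (\<lambda>y. (norm (y - X (real n * h)))\<^sup>2) \<le>
    real n * (C * h\<^sup>2) * exp (2 * L * h) ^ n"
proof (induction n)
  case 0
  then show ?case by (simp add: X0)
next
  case (Suc n)
  define q where "q = exp (2 * L * h)"
  have q: "1 + 2 * L * h \<le> q" "1 \<le> q" using L0 h by (simp_all add: q_def exp_ge_add_one_self)
  define d where "d = C * h\<^sup>2"
  have d: "0 \<le> d" using C0 by (simp add: d_def)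
  let ?V = "\<lambda>n. measure_pmf.expectation (law h n) (\<lambda>y. (norm (y - X (real n * h)))\<^sup>2)"
  have t: "0 \<le> real n * h" "real n * h + h \<le> T" using Suc.prems h by (simp_all add: algebra_simps)
  have "?V (Suc n) = measure_pmf.expectation (law h n)
      (\<lambda>a. measure_pmf.expectation (step_law h a) (\<lambda>y. (norm (y - X (real n * h + h)))\<^sup>2))"
    by (simp add: expectation_bind_pmf_finite finite_law finite_set_pmf_abm_kernel algebra_simps)
  also have "\<dots> \<le> measure_pmf.expectation (law h n) (\<lambda>a. (1 + 2 * L * h) * (norm (a - X (real n * h)))\<^sup>2 + d)"
    unfolding d_def
    by (intro integral_mono_AE integrable_measure_pmf_finite finite_law AE_pmfI second_moment_step[OF h(1,2) t])
      (rule law_box[OF h(1,3)])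
  also have "\<dots> = (1 + 2 * L * h) * ?V n + d"
    by (subst Bochner_Integration.integral_add) (auto intro: integrable_measure_pmf_finite finite_law)
  also have "\<dots> \<le> q * (real n * d * q ^ n) + d * q ^ Suc n"
  proof (intro add_mono mult_mono)
    show "?V n \<le> real n * d * q ^ n" using Suc.IH t h by (simp add: d_def q_def)
    show "d \<le> d * q ^ Suc n" using mult_left_mono[OF one_le_power[OF q(2), of "Suc n"] d] by simp
  qed (use q in auto)
  also have "\<dots> = real (Suc n) * d * q ^ Suc n" by (simp add: algebra_simps)
  finally show ?case by (simp add: d_def q_def)
qed

text \<open>One factor h of \<open>n * C * h\<^sup>2\<close> is spent on
  \<open>n * h \<le> T\<close>; the growth factor is at most \<open>exp (2 * L * T)\<close>.\<close>

definition C' where "C' = T * C * exp (2 * L * T)"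

lemma second_moment_le:
  assumes h: "0 < h" "h \<le> 1" "N * h \<le> 1" and n: "real n * h \<le> T"
  shows "measure_pmf.expectation (law h n) (\<lambda>y. (norm (y - X (real n * h)))\<^sup>2) \<le> C' * h"
proof -
  have "exp (2 * L * h) ^ n = exp (2 * L * (real n * h))"
    by (simp add: exp_of_nat_mult[symmetric] mult_ac)
  also have "\<dots> \<le> exp (2 * L * T)" using n L0 by (simp add: mult_left_mono)
  finally have e: "exp (2 * L * h) ^ n \<le> exp (2 * L * T)" .
  have "real n * (C * h\<^sup>2) * exp (2 * L * h) ^ n = (real n * h) * (C * h) * exp (2 * L * h) ^ n"
    by (simp add: power2_eq_square)
  also have "\<dots> \<le> T * (C * h) * exp (2 * L * T)"
    using n e T C0 h by (intro mult_mono) auto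
  finally show ?thesis using second_moment[of h n] h n by (simp add: C'_def mult_ac)
qed

lemma step_law_measurable:
  "\<forall>S\<in>sets borel. (\<lambda>y. measure_pmf.prob (step_law h y) S) \<in> borel_measurable borel"
  by (rule measurable_abm_kernel[OF p p_cont])

text \<open>Chebyshev's inequality, carried out under the \<open>pmf\<close> law of the single
  state.\<close>

lemma deviation_prob:
  assumes mc: "markov_chain M (step_law h) x0 x"
    and h: "0 < h" "h \<le> 1" "N * h \<le> 1" and n: "real n * h \<le> T" and \<epsilon>: "0 < \<epsilon>"
  shows "measure M {\<omega> \<in> space M. \<epsilon> < dist (x n \<omega>) (X (real n * h))} \<le> C' * h / \<epsilon>\<^sup>2"
proof -
  let ?c = "X (real n * h)"
  have [measurable]: "x n \<in> borel_measurable M" using mc by (simp add: markov_chain_def)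
  have S: "{y. \<epsilon> < dist y ?c} \<in> sets borel" by measurable
  have "measure M {\<omega> \<in> space M. \<epsilon> < dist (x n \<omega>) ?c} = (\<integral>\<omega>. indicator {y. \<epsilon> < dist y ?c} (x n \<omega>) \<partial>M)"
    by (subst Bochner_Integration.integral_cong[OF refl, where
        g = "indicator {\<omega> \<in> space M. \<epsilon> < dist (x n \<omega>) ?c}"]) (auto simp: indicator_def)
  also have "\<dots> = measure_pmf.expectation (law h n) (indicator {y. \<epsilon> < dist y ?c})"
    using S by (intro markov_chain_expectation[OF mc step_law_measurable]) auto
  also have "\<dots> \<le> measure_pmf.expectation (law h n) (\<lambda>y. (norm (y - ?c))\<^sup>2 / \<epsilon>\<^sup>2)"
  proof (intro integral_mono_AE integrable_measure_pmf_finite finite_law AE_pmfI)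
    fix y :: "real^'n"
    have "1 \<le> (norm (y - ?c))\<^sup>2 / \<epsilon>\<^sup>2" if "\<epsilon> < dist y ?c"
      using that \<epsilon> power_mono[of \<epsilon> "dist y ?c" 2] by (simp add: dist_norm)
    then show "indicator {y. \<epsilon> < dist y ?c} y \<le> (norm (y - ?c))\<^sup>2 / \<epsilon>\<^sup>2"
      by (simp add: indicator_def)
  qed
  also have "\<dots> \<le> C' * h / \<epsilon>\<^sup>2"
    using divide_right_mono[OF second_moment_le[OF h n], of "\<epsilon>\<^sup>2"] by simp
  finally show ?thesis .
qed

section \<open>From single times to whole paths\<close>

text \<open>Off one null set every transition lies in the support of the kernel, so the path stays
  in the box and each step has length at most \<open>2 * R * (N * h)\<close>.\<close>

lemma path_lipschitz:
  assumes mc: "markov_chain M (step_law h) x0 x" and h: "0 \<le> h" "N * h \<le> 1"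
  shows "AE \<omega> in M. \<forall>m n. m \<le> n \<longrightarrow> dist (x n \<omega>) (x m \<omega>) \<le> 2 * R * N * h * real (n - m)"
proof -
  have "AE \<omega> in M. x 0 \<omega> = x0" using mc by (simp add: markov_chain_def)
  with markov_chain_AE_step[OF mc step_law_measurable] show ?thesis
  proof eventually_elim
    case (elim \<omega>)
    have Nh: "0 \<le> N * h" using h N0 by simp
    have box: "\<bar>x n \<omega> $ k\<bar> \<le> R" for n k
    proof (induction n arbitrary: k)
      case 0
      then show ?case using elim x0_box by simp
    next
      case (Suc n)
      show ?case using abm_kernel_box(1)[OF Nh h(2) Suc.IH elim(1)[rule_format]] .
    qed
    have step: "dist (x (Suc n) \<omega>) (x n \<omega>) \<le> 2 * R * N * h" for n
      using abm_kernel_box(2)[OF Nh h(2) box elim(1)[rule_format]] by (simp add: mult_ac)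
    show ?case
    proof (intro allI impI)
      fix m n :: nat assume "m \<le> n"
      then show "dist (x n \<omega>) (x m \<omega>) \<le> 2 * R * N * h * real (n - m)"
      proof (induction n rule: dec_induct)
        case (step n)
        then show ?case
          using dist_triangle[of "x (Suc n) \<omega>" "x m \<omega>" "x n \<omega>"] \<open>\<And>n. dist (x (Suc n) \<omega>) (x n \<omega>) \<le> _\<close>[of n]
          by (simp add: Suc_diff_le algebra_simps)
      qed simp
    qed
  qed
qed

text \<open>Since both paths are Lipschitz in time, the deviation need only be controlled at every
  \<open>q\<close>-th step with \<open>q \<approx> h powr (- 1/2)\<close>: these are \<open>O(h powr (- 1/2))\<close> many times, each
  with exceptional probability \<open>O(h)\<close>, and between them the paths move by \<open>O(h powr (1/2))\<close>.\<close>

lemma uniform_deviation_prob: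
  assumes mc: "markov_chain M (step_law h) x0 x"
    and h: "0 < h" "h \<le> 1" "N * h \<le> 1" and \<epsilon>: "0 < \<epsilon>"
    and small: "(2 * R * N + B) * (2 * sqrt h) \<le> \<epsilon>"
  shows "1 - (T * sqrt h + h) * (C' / \<epsilon>\<^sup>2) \<le>
    measure M {\<omega> \<in> space M. skorokhod_dist T (piecewise_trajectory T h x \<omega>) X < 3 * \<epsilon>}"
proof -
  interpret prob_space M using mc by (simp add: markov_chain_def)
  have x[measurable]: "x n \<in> borel_measurable M" for n using mc by (simp add: markov_chain_def)
  note X_cadlag = abm_ode_solution_cadlag[OF X]
  define s where "s = sqrt h"
  have s: "0 < s" "s * s = h" "s \<le> 1" using h by (simp_all add: s_def)
  \<comment> \<open>Rounding up gives \<open>s \<le> q * h\<close>, hence few grid times, and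
    \<open>q * h \<le> s + h \<le> 2 * s\<close>, hence short gaps.\<close>
  define q where "q = nat \<lceil>1 / s\<rceil>"
  have q1: "1 / s \<le> real q" unfolding q_def by linarith
  have q2: "real q \<le> 1 / s + 1" unfolding q_def using s by (simp add: of_nat_nat)
  have "0 < 1 / s" using s by simp
  then have "0 < real q" using q1 by linarith
  then have q0: "0 < q" by simp
  have inv: "1 / s * h = s" using s by (simp flip: s(2))
  have qh1: "s \<le> real q * h" using mult_right_mono[OF q1, of h] h inv by simp
  have "h \<le> s" using s mult_left_mono[of s 1 s] by simp
  have "real q * h \<le> (1 / s + 1) * h" using q2 h by (intro mult_right_mono) auto
  also have "\<dots> = s + h" using inv by (simp add: distrib_right)
  finally have qh2: "real q * h \<le> 2 * s" using \<open>h \<le> s\<close> by linarith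
  \<comment> \<open>Consecutive grid times are at least s apart, so at most \<open>T / s + 1\<close>
    of them lie in [0,T].\<close>
  define I where "I = {k. real (q * k) * h \<le> T}"
  have "I \<subseteq> {..nat \<lfloor>T / s\<rfloor>}"
  proof
    fix k assume "k \<in> I"
    then have "s * real k \<le> T"
      using mult_right_mono[OF qh1, of "real k"] by (simp add: I_def mult_ac)
    then have "real k \<le> T / s" using s by (simp add: field_simps)
    then show "k \<in> {..nat \<lfloor>T / s\<rfloor>}" by (simp add: le_nat_floor)
  qed
  then have finI: "finite I" and "card I \<le> Suc (nat \<lfloor>T / s\<rfloor>)"
    using finite_subset card_mono[of "{..nat \<lfloor>T / s\<rfloor>}" I] by auto
  then have "real (card I) \<le> real (nat \<lfloor>T / s\<rfloor>) + 1" by linarith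
  moreover have "real (nat \<lfloor>T / s\<rfloor>) \<le> T / s" using T s by (intro of_nat_floor) simp
  ultimately have cardI: "real (card I) \<le> T / s + 1" by linarith
  let ?bad = "\<lambda>n. {\<omega> \<in> space M. \<epsilon> < dist (x n \<omega>) (X (real n * h))}"
  define Bad where "Bad = (\<Union>k\<in>I. ?bad (q * k))"
  have bad_sets: "?bad n \<in> sets M" for n
  proof -
    have "{y. \<epsilon> < dist y (X (real n * h))} \<in> sets borel" by measurable
    from measurable_sets[OF x this, of n] show ?thesis
      by (simp add: vimage_def Int_def conj_commute)
  qed
  then have Bad: "Bad \<in> sets M" unfolding Bad_def using finI by auto
  have C'0: "0 \<le> C'" using T C0 by (simp add: C'_def)
  have "prob Bad \<le> (\<Sum>k\<in>I. prob (?bad (q * k)))"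
    unfolding Bad_def using finI bad_sets by (intro finite_measure_subadditive_finite) auto
  also have "\<dots> \<le> (\<Sum>k\<in>I. C' * h / \<epsilon>\<^sup>2)"
    by (intro sum_mono deviation_prob[OF mc h _ \<epsilon>]) (simp add: I_def)
  also have "\<dots> = real (card I) * (C' * h / \<epsilon>\<^sup>2)" by simp
  also have "\<dots> \<le> (T / s + 1) * (C' * h / \<epsilon>\<^sup>2)"
    using cardI C'0 h by (intro mult_right_mono) auto
  also have "\<dots> = ((T / s + 1) * h) * (C' / \<epsilon>\<^sup>2)" by simp
  also have "(T / s + 1) * h = T * (1 / s * h) + h" by (simp add: distrib_right)
  also have "\<dots> = T * s + h" unfolding inv ..
  finally have probBad: "prob Bad \<le> (T * s + h) * (C' / \<epsilon>\<^sup>2)" .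
  let ?Y = "piecewise_trajectory T h x"
  let ?G = "{\<omega> \<in> space M. skorokhod_dist T (?Y \<omega>) X < 3 * \<epsilon>}"
  have "1 - prob Bad = prob (space M - Bad)" using prob_compl[OF Bad] by simp
  also have "\<dots> \<le> prob ?G"
  proof (rule finite_measure_mono_AE)
    show "?G \<in> sets M"
      by (intro skorokhod_ball_event[OF T X_cadlag] piecewise_trajectory_measurable[OF T h(1) x])
    show "AE \<omega> in M. \<omega> \<in> space M - Bad \<longrightarrow> \<omega> \<in> ?G"
      using path_lipschitz[OF mc less_imp_le[OF h(1)] h(3)]
    proof eventually_elim
      case (elim \<omega>)
      show ?case
      proof
        assume w: "\<omega> \<in> space M - Bad"
        \<comment> \<open>One \<open>\<epsilon>\<close> is the deviation at the preceding grid time,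
          the other the motion of both paths since then; the third \<open>\<epsilon>\<close> of the
          claim makes the inequality strict.\<close>
        have "dist (?Y \<omega> t) (X t) \<le> 2 * \<epsilon>" if t: "t \<in> {0..T}" for t
        proof -
          define n where "n = nat \<lfloor>t / h\<rfloor>"
          define m where "m = q * (n div q)"
          define \<tau> where "\<tau> = real m * h"
          have n: "real n \<le> t / h" "t / h < real n + 1"
            using t h by (simp_all add: n_def of_nat_nat)
          then have n': "real n * h \<le> t" "t < (real n + 1) * h"
            using h by (simp_all add: pos_le_divide_eq pos_divide_less_eq)
          have mn: "m \<le> n" "n - m < q"
            using q0 by (simp_all add: m_def minus_mult_div_eq_mod)
          \<comment> \<open>The spare unit in \<open>n - m < q\<close> absorbs the fraction of a
            step between \<open>n * h\<close> and t, so that \<open>t - \<tau>\<close> stays below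
            \<open>q * h\<close>.\<close>
          then have mn': "real m \<le> real n" "real n + 1 \<le> real m + real q" by linarith+
          then have "\<tau> \<le> real n * h" "(real n + 1) * h \<le> \<tau> + real q * h"
            using h mult_right_mono[OF mn'(2), of h] by (simp_all add: \<tau>_def distrib_right)
          then have \<tau>: "\<tau> \<le> t" "t - \<tau> \<le> 2 * s" using n' qh2 by linarith+
          have \<tau>T: "\<tau> \<in> {0..T}" using \<tau> t h by (auto simp: \<tau>_def)
          have 1: "dist (x n \<omega>) (x m \<omega>) \<le> 2 * R * N * (2 * s)"
          proof -
            have "h * real (n - m) \<le> h * real q" using mn h by (intro mult_left_mono) auto
            also have "\<dots> \<le> 2 * s" using qh2 by (simp add: mult.commute)
            finally have "(2 * R * N) * (h * real (n - m)) \<le> (2 * R * N) * (2 * s)"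
              using R0 N0 by (intro mult_left_mono) auto
            moreover have "dist (x n \<omega>) (x m \<omega>) \<le> (2 * R * N) * (h * real (n - m))"
              using elim[rule_format, OF mn(1)] by (simp add: mult.assoc)
            ultimately show ?thesis by (rule order_trans[rotated])
          qed
          have 2: "dist (x m \<omega>) (X \<tau>) \<le> \<epsilon>"
          proof -
            have "n div q \<in> I"
              using \<tau>T by (simp only: I_def \<tau>_def m_def mem_Collect_eq atLeastAtMost_iff)
            then have "?bad m \<subseteq> Bad" unfolding Bad_def m_def by (rule UN_upper)
            then show ?thesis using w unfolding \<tau>_def by fastforce
          qed
          have 3: "dist (X \<tau>) (X t) \<le> B * (2 * s)"
            using X_lipschitz[OF \<tau>T t] mult_left_mono[OF \<tau>(2) B0] \<tau>(1) by simp
          have "?Y \<omega> t = x n \<omega>" using t by (simp add: piecewise_trajectory_def n_def)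
          then have "dist (?Y \<omega> t) (X t) \<le> dist (x n \<omega>) (x m \<omega>) + dist (x m \<omega>) (X \<tau>) + dist (X \<tau>) (X t)"
            using dist_triangle[of "x n \<omega>" "X t" "x m \<omega>"] dist_triangle[of "x m \<omega>" "X t" "X \<tau>"] by simp
          also have "\<dots> \<le> (2 * R * N + B) * (2 * s) + \<epsilon>"
            using 1 2 3 by (simp only: distrib_right)
          also have "\<dots> \<le> 2 * \<epsilon>" using small unfolding s_def by linarith
          finally show ?thesis .
        qed
        then have "skorokhod_dist T (?Y \<omega>) X \<le> 2 * \<epsilon>"
          using \<epsilon> by (intro skorokhod_dist_le_uniform[OF piecewise_trajectory_cadlag[OF h(1)] X_cadlag]) auto
        then show "\<omega> \<in> ?G" using w \<epsilon> by simp
      qed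
    qed
  qed
  finally show ?thesis using probBad by (simp add: s_def)
qed

lemma trajectory_converges_in_probability:
  assumes mc: "\<And>h. 0 < h \<Longrightarrow> markov_chain (M h) (step_law h) x0 (x h)"
  shows "converges_in_probability T M (\<lambda>h. piecewise_trajectory T h (x h)) X (at_right 0)"
  unfolding converges_in_probability_def
proof (intro allI impI)
  fix e :: real assume e: "0 < e"
  define \<epsilon> where "\<epsilon> = e / 3"
  have \<epsilon>: "0 < \<epsilon>" using e by (simp add: \<epsilon>_def)
  let ?P = "\<lambda>h. measure (M h) {\<omega> \<in> space (M h). skorokhod_dist T (piecewise_trajectory T h (x h) \<omega>) X < e}"
  have small: "((\<lambda>h. (2 * R * N + B) * (2 * sqrt h)) \<longlongrightarrow> 0) (at_right 0)"
    by (auto intro!: tendsto_eq_intros)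
  have pos: "\<forall>\<^sub>F h::real in at_right 0. 0 < h" by (rule eventually_at_right_less)
  have "1 / N > 0" using N0 by simp
  then have le: "\<forall>\<^sub>F h in at_right 0. h < min 1 (1 / N)"
    by (intro order_tendstoD(2)[OF tendsto_ident_at]) simp
  have low: "\<forall>\<^sub>F h in at_right 0. 1 - (T * sqrt h + h) * (C' / \<epsilon>\<^sup>2) \<le> ?P h"
    using order_tendstoD(2)[OF small \<epsilon>] pos le
  proof eventually_elim
    case (elim h)
    then have "N * h \<le> 1" using N0 by (simp add: field_simps)
    then have "1 - (T * sqrt h + h) * (C' / \<epsilon>\<^sup>2) \<le>
        measure (M h) {\<omega> \<in> space (M h). skorokhod_dist T (piecewise_trajectory T h (x h) \<omega>) X < 3 * \<epsilon>}"
      using elim \<epsilon> by (intro uniform_deviation_prob mc) auto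
    then show ?case by (simp add: \<epsilon>_def)
  qed
  have up: "\<forall>\<^sub>F h in at_right 0. ?P h \<le> 1"
    using pos
  proof eventually_elim
    case (elim h)
    then interpret prob_space "M h" using mc by (simp add: markov_chain_def)
    show ?case by (rule prob_le_1)
  qed
  have "((\<lambda>h. 1 - (T * sqrt h + h) * (C' / \<epsilon>\<^sup>2)) \<longlongrightarrow> 1) (at_right 0)"
    using \<epsilon> by (auto intro!: tendsto_eq_intros)
  then show "(?P \<longlongrightarrow> 1) (at_right 0)"
    by (rule tendsto_sandwich[OF low up _ tendsto_const])
qed

end

lemma abm_converges_in_probability:
  fixes p :: "'n::finite \<Rightarrow> 'n \<Rightarrow> real^'n \<Rightarrow> real"
  assumes T: "0 \<le> T" and p: "\<And>i j y. p i j y \<in> {0..1}" and lip: "\<And>i j. \<exists>C. C-lipschitz_on UNIV (p i j)"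
    and mc: "\<And>h. h > 0 \<Longrightarrow> markov_chain (M h) (abm_kernel p (real CARD('n) * h)) x0 (x h)"
    and X: "abm_ode_solution p T x0 X"
  shows "converges_in_probability T M (\<lambda>h. piecewise_trajectory T h (x h)) X (at_right 0)"
proof -
  \<comment> \<open>A cadlag path on a compact interval is bounded, which supplies a box for an
    arbitrary solution.\<close>
  obtain R where R: "\<And>t. t \<in> {0..T} \<Longrightarrow> norm (X t) \<le> R"
    using cadlag_bounded[OF abm_ode_solution_cadlag[OF X]] unfolding bounded_iff by blast
  have box: "\<bar>X t $ k\<bar> \<le> R" if "t \<in> {0..T}" for t k
    using R[OF that] component_le_norm_cart order_trans by blast
  have "0 \<le> R" using order_trans[OF norm_ge_zero R[of 0]] T by simp
  then obtain L where L: "L-lipschitz_on {y. \<forall>k. \<bar>y $ k\<bar> \<le> R} (abm_drift p)"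
    using abm_drift_lipschitz[of p R, OF p lip] by blast
  have "continuous_on UNIV (p i j)" for i j
    using lip lipschitz_on_continuous_on by blast
  then interpret abm_limit p T x0 X R L "real CARD('n)"
    using T p L X box by unfold_locales auto
  show ?thesis using mc by (rule trajectory_converges_in_probability)
qed

theorem mainTheorem1:
  fixes T :: real
    and x0 :: "real^'n::finite"
    and p :: "'n \<Rightarrow> 'n \<Rightarrow> real^'n \<Rightarrow> real"
    and M :: "real \<Rightarrow> 'w measure"
    and x :: "real \<Rightarrow> nat \<Rightarrow> 'w \<Rightarrow> real^'n"
  assumes "0 \<le> T"
    and "\<And>i j y. p i j y \<in> {0..1}"
    and "\<And>i j. \<exists>C. C-lipschitz_on UNIV (p i j)"
    and "\<And>h. h > 0 \<Longrightarrow> markov_chain (M h) (abm_kernel p (real CARD('n) * h)) x0 (x h)"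
  shows "(\<forall>h>0. piecewise_trajectory T h (x h) \<in> M h \<rightarrow>\<^sub>M skorokhod_borel T) \<and>
    (\<exists>!X. abm_ode_solution p T x0 X) \<and>
    (\<forall>X. abm_ode_solution p T x0 X \<longrightarrow>
       X \<in> cadlag T \<and>
       converges_in_distribution T M (\<lambda>h. piecewise_trajectory T h (x h))
         (measure_pmf (return_pmf X)) (\<lambda>Y. Y) (at_right 0) \<and>
       converges_in_probability T M (\<lambda>h. piecewise_trajectory T h (x h)) X (at_right 0))"
proof -
  have meas: "piecewise_trajectory T h (x h) \<in> M h \<rightarrow>\<^sub>M skorokhod_borel T" if "h > 0" for h
    using assms(4)[OF that] by (intro piecewise_trajectory_measurable[OF assms(1) that])
      (simp add: markov_chain_def)
  have ev: "\<forall>\<^sub>F h in at_right 0. prob_space (M h) \<and> piecewise_trajectory T h (x h) \<in> M h \<rightarrow>\<^sub>M skorokhod_borel T"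
    using eventually_at_right_less[of 0]
    by eventually_elim (use meas assms(4) in \<open>auto simp: markov_chain_def\<close>)
  have prob: "converges_in_probability T M (\<lambda>h. piecewise_trajectory T h (x h)) X (at_right 0)"
    if "abm_ode_solution p T x0 X" for X
    by (rule abm_converges_in_probability[OF assms that])
  have "X = X'" if "abm_ode_solution p T x0 X" "abm_ode_solution p T x0 X'" for X X'
    by (rule converges_in_probability_unique[OF assms(1) abm_ode_solution_cadlag[OF that(1)]
      abm_ode_solution_cadlag[OF that(2)] _ ev prob[OF that(1)] prob[OF that(2)]]) simp
  moreover obtain X where "abm_ode_solution p T x0 X"
    using abm_ode_solution_exists[of T p x0, OF assms(1-3)] by blast
  ultimately have "\<exists>!X. abm_ode_solution p T x0 X" by blast
  moreover have "converges_in_distribution T M (\<lambda>h. piecewise_trajectory T h (x h))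
      (measure_pmf (return_pmf X)) (\<lambda>Y. Y) (at_right 0)" if "abm_ode_solution p T x0 X" for X
    by (rule converges_in_probability_imp_distribution[OF assms(1) abm_ode_solution_cadlag[OF that] ev prob[OF that]])
  ultimately show ?thesis using meas prob abm_ode_solution_cadlag by blast
qed

end
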